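(* Let $p\ge2$. Suppose each of $k$ servers holds a vector $f(j)\in\mathbb{Z}_{\ge0}^n$ and let $f=\sum_{j\in[k]}f(j)$. There is a protocol that, with probability $1-\frac{1}{\mathrm{poly}(n)}$, outputs an estimate $\widehat{\|f\|_p^p}$ of $\|f\|_p^p$ such that $\mathbb{E}[\widehat{\|f\|_p^p}]=\|f\|_p^p$ and $\mathbb{E}[(\widehat{\|f\|_p^p})^2]=O(\|f\|_p^{2p})$, using $k^{p-1}\,\mathrm{polylog}(n)$ bits of communication.
   Context: One-shot coordinator model: $k$ servers and a coordinator with private two-way channels; communication cost is the total number of bits exchanged. $\|f\|_p^p=\sum_i f_i^p$. The entries of $f$ are at most $\mathrm{poly}(n)$. *)

theory Defs
  imports "HOL-Probability.Probability" "HOL-Probability.Product_PMF"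
begin

type_synonym message = "bool list"

text \<open>All exchanges so far, in order: the server addressed, the coordinator's message to it, and
  its answer.\<close>

type_synonym transcript = "(nat \<times> message \<times> message) list"

text \<open>A halting coordinator either outputs an estimate (\<^term>\<open>Some v\<close>) or declares failure
  (\<^term>\<open>None\<close>).\<close>

datatype action = Query nat message | Halt "real option"

text \<open>Coins are private and mutually independent; there is no shared randomness. Coins of type
  \<^typ>\<open>nat\<close> are enough for any discrete source, since a pmf has countable support. The arguments of
  \<open>server_reply\<close> are the server, its own input vector, its own coin, the earlier exchanges on its
  own channel, and the message just received, so a server learns nothing about the other
  channels. Local computation is unrestricted.\<close>

record protocol =
  coord_coin :: "nat pmf"
  server_coin :: "nat \<Rightarrow> nat pmf"
  coord_step :: "nat \<Rightarrow> transcript \<Rightarrow> action"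
  server_reply :: "nat \<Rightarrow> nat list \<Rightarrow> nat \<Rightarrow> (message \<times> message) list \<Rightarrow> message \<Rightarrow> message"

text \<open>Messages are nonempty: otherwise information could be conveyed for free by the number of
  empty exchanges.\<close>

definition valid_protocol :: "nat \<Rightarrow> protocol \<Rightarrow> bool" where
  "valid_protocol k P \<longleftrightarrow>
     (\<forall>r \<tau> j m. coord_step P r \<tau> = Query j m \<longrightarrow> j < k \<and> m \<noteq> []) \<and>
     (\<forall>j v r h m. server_reply P j v r h m \<noteq> [])"

definition channel :: "nat \<Rightarrow> transcript \<Rightarrow> (message \<times> message) list" where
  "channel j \<tau> = map snd (filter (\<lambda>e. fst e = j) \<tau>)"

text \<open>The transcript after at most \<open>t\<close> exchanges; it is constant once the coordinator has halted.
  Here \<open>f j\<close> is the input of server \<open>j\<close>, \<open>r\<close> the coordinator's coin and \<open>s j\<close> the coin of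
  server \<open>j\<close>.\<close>

primrec run :: "protocol \<Rightarrow> (nat \<Rightarrow> nat list) \<Rightarrow> nat \<Rightarrow> (nat \<Rightarrow> nat) \<Rightarrow> nat \<Rightarrow> transcript" where
  "run P f r s 0 = []"
| "run P f r s (Suc t) =
     (let \<tau> = run P f r s t in
      case coord_step P r \<tau> of
        Halt _ \<Rightarrow> \<tau>
      | Query j m \<Rightarrow> \<tau> @ [(j, m, server_reply P j (f j) (s j) (channel j \<tau>) m)])"

text \<open>A run that never halts has no output and counts as a failure.\<close>

definition result :: "protocol \<Rightarrow> (nat \<Rightarrow> nat list) \<Rightarrow> nat \<Rightarrow> (nat \<Rightarrow> nat) \<Rightarrow> real option" where
  "result P f r s =
     (case coord_step P r (run P f r s (LEAST t. \<exists>v. coord_step P r (run P f r s t) = Halt v)) of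
        Halt v \<Rightarrow> v
      | Query _ _ \<Rightarrow> None)"

definition bits :: "transcript \<Rightarrow> nat" where
  "bits \<tau> = (\<Sum>(j, m, m') \<leftarrow> \<tau>. length m + length m')"

definition coins :: "nat \<Rightarrow> protocol \<Rightarrow> (nat \<times> (nat \<Rightarrow> nat)) pmf" where
  "coins k P = pair_pmf (coord_coin P) (Pi_pmf {..<k} 0 (server_coin P))"

definition result_pmf :: "nat \<Rightarrow> protocol \<Rightarrow> (nat \<Rightarrow> nat list) \<Rightarrow> real option pmf" where
  "result_pmf k P f = map_pmf (\<lambda>(r, s). result P f r s) (coins k P)"

text \<open>The law of the estimate, conditioned on the event that one is output.\<close>

definition estimate_pmf :: "nat \<Rightarrow> protocol \<Rightarrow> (nat \<Rightarrow> nat list) \<Rightarrow> real pmf" where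
  "estimate_pmf k P f = map_pmf the (cond_pmf (result_pmf k P f) (range Some))"

text \<open>Worst case over the coins and over all finite stages of the run; as every exchange costs at
  least two bits, a bound forces the run to halt.\<close>

definition uses_at_most :: "nat \<Rightarrow> protocol \<Rightarrow> (nat \<Rightarrow> nat list) \<Rightarrow> real \<Rightarrow> bool" where
  "uses_at_most k P f B \<longleftrightarrow>
     (\<forall>(r, s) \<in> set_pmf (coins k P). \<forall>t. real (bits (run P f r s t)) \<le> B)"

definition aggregate :: "nat \<Rightarrow> (nat \<Rightarrow> nat list) \<Rightarrow> nat \<Rightarrow> nat" where
  "aggregate k f i = (\<Sum>j<k. f j ! i)"

definition lp_pow :: "real \<Rightarrow> nat \<Rightarrow> (nat \<Rightarrow> nat) \<Rightarrow> real" where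
  "lp_pow p n v = (\<Sum>i<n. real (v i) powr p)"

definition admissible :: "nat \<Rightarrow> nat \<Rightarrow> nat \<Rightarrow> (nat \<Rightarrow> nat list) \<Rightarrow> bool" where
  "admissible a n k f \<longleftrightarrow>
     (\<forall>j<k. length (f j) = n) \<and> (\<forall>i<n. aggregate k f i \<le> n ^ a)"

end

theory Submission
  imports Defs
begin

text \<open>
  Give entry \<open>f\<^sub>i(j)\<close> the integer weight \<open>w = \<lfloor>f\<^sub>i(j)\<^sup>p\<rfloor>\<close> and let \<open>S\<close> be the total weight. A draw picks
  \<open>(j, i)\<close> proportionally to weight. Evaluating \<open>f\<^sub>i\<close> exactly costs \<open>k\<close> queries, and \<open>k\<^sup>p\<^sup>-\<^sup>1\<close> draws
  would have to be evaluated, a factor \<open>k\<close> too many. Instead, the draws come in blocks of \<open>k\<close>;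
  draw \<open>t\<close> is compared with server \<open>t\<close> only and receives the cheap score
  \<open>W\<^sub>t = min 1 (f\<^sub>i(t) / f\<^sub>i(j))\<close>. One draw of the block is chosen proportionally to its score, and
  only its coordinate \<open>i\<close> is evaluated on all servers; the block returns \<open>(\<Sum>\<^sub>t W\<^sub>t) S f\<^sub>i\<^sup>p / A\<^sub>i\<close> with
  \<open>A\<^sub>i = \<Sum>\<^sub>j \<Sum>\<^sub>t w(f\<^sub>i(j)) min 1 (f\<^sub>i(t) / f\<^sub>i(j))\<close>. This is unbiased, and since
  \<open>A\<^sub>i \<le> f\<^sub>i\<^sup>p \<le> 4 k\<^sup>p\<^sup>-\<^sup>2 A\<^sub>i\<close>, its second moment is at most \<open>8 k\<^sup>p\<^sup>-\<^sup>2\<close> times the squared mean. Averaging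
  \<open>\<lceil>k\<^sup>p\<^sup>-\<^sup>2\<rceil>\<close> independent blocks gives second moment at most \<open>9\<close> times the squared mean with
  \<open>O(k\<^sup>p\<^sup>-\<^sup>1)\<close> messages of \<open>O(log n)\<close> bits. The protocol never fails, and the servers are deterministic.
\<close>

section \<open>Coordinator programs and their compilation to protocols\<close>

text \<open>Programs of the coordinator: \<open>Ask j q c\<close> sends the number \<open>q\<close> to server \<open>j\<close> and continues with
  its numerical reply.\<close>

datatype prog = Ret real | Ask nat nat "nat \<Rightarrow> prog"

primrec outcome :: "(nat \<Rightarrow> nat \<Rightarrow> nat) \<Rightarrow> prog \<Rightarrow> real" where
  "outcome orc (Ret x) = x"
| "outcome orc (Ask j q c) = outcome orc (c (orc j q))"

primrec queries :: "(nat \<Rightarrow> nat \<Rightarrow> nat) \<Rightarrow> prog \<Rightarrow> (nat \<times> nat) list" where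
  "queries orc (Ret x) = []"
| "queries orc (Ask j q c) = (j, q) # queries orc (c (orc j q))"

text \<open>The coordinator's step sees only its coin and the transcript, so the state of the
  program is recovered by replaying the recorded replies.\<close>

primrec resume :: "(message \<Rightarrow> nat) \<Rightarrow> transcript \<Rightarrow> prog \<Rightarrow> prog" where
  "resume dec [] P = P"
| "resume dec (e # \<tau>) P =
     resume dec \<tau> (case P of Ret x \<Rightarrow> Ret x | Ask j q c \<Rightarrow> c (dec (snd (snd e))))"

text \<open>Addresses are reduced modulo \<open>k\<close>, so that every program addresses existing
  servers only.\<close>

definition compiled_step ::
    "nat \<Rightarrow> (nat \<Rightarrow> message) \<Rightarrow> (message \<Rightarrow> nat) \<Rightarrow> prog \<Rightarrow> transcript \<Rightarrow> action" where
  "compiled_step k enc dec P \<tau> =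
     (case resume dec \<tau> P of Ret x \<Rightarrow> Halt (Some x) | Ask j q c \<Rightarrow> Query (j mod k) (enc q))"

definition compiled ::
    "nat \<Rightarrow> (nat \<Rightarrow> message) \<Rightarrow> (message \<Rightarrow> nat) \<Rightarrow> (nat list \<Rightarrow> nat \<Rightarrow> nat) \<Rightarrow> 'w pmf \<Rightarrow>
     ('w \<Rightarrow> prog) \<Rightarrow> protocol" where
  "compiled k enc dec ans R pr =
     \<lparr>coord_coin = map_pmf (to_nat_on (set_pmf R)) R,
      server_coin = (\<lambda>_. return_pmf 0),
      coord_step = (\<lambda>r. compiled_step k enc dec (pr (from_nat_into (set_pmf R) r))),
      server_reply = (\<lambda>j v r h m. enc (ans v (dec m)))\<rparr>"

text \<open>The oracle includes both passes through the code, so compilation is correct for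
  arbitrary \<open>enc\<close> and \<open>dec\<close>; losslessness is used only in
  \<open>responder_answer\<close>.\<close>

definition responder ::
    "nat \<Rightarrow> (nat \<Rightarrow> message) \<Rightarrow> (message \<Rightarrow> nat) \<Rightarrow> (nat list \<Rightarrow> nat \<Rightarrow> nat) \<Rightarrow>
     (nat \<Rightarrow> nat list) \<Rightarrow> nat \<Rightarrow> nat \<Rightarrow> nat" where
  "responder k enc dec ans f j q = dec (enc (ans (f (j mod k)) (dec (enc q))))"

definition trace ::
    "nat \<Rightarrow> (nat \<Rightarrow> message) \<Rightarrow> (message \<Rightarrow> nat) \<Rightarrow> (nat list \<Rightarrow> nat \<Rightarrow> nat) \<Rightarrow>
     (nat \<Rightarrow> nat list) \<Rightarrow> prog \<Rightarrow> transcript" where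
  "trace k enc dec ans f P =
     map (\<lambda>(j, q). (j mod k, enc q, enc (ans (f (j mod k)) (dec (enc q)))))
       (queries (responder k enc dec ans f) P)"

lemma valid_protocol_compiled:
  assumes "k \<ge> 1" "\<And>x. enc x \<noteq> []"
  shows "valid_protocol k (compiled k enc dec ans R pr)"
  using assms
  by (auto simp: valid_protocol_def compiled_def compiled_step_def split: prog.splits)

text \<open>Induction on the program: the first exchange of the trace leads \<open>resume\<close> to
  the continuation. Since \<open>take\<close> saturates, all late stages see the full trace and
  halt.\<close>

lemma compiled_step_trace:
  "compiled_step k enc dec P (take t (trace k enc dec ans f P)) =
     (if t < length (trace k enc dec ans f P)
      then Query (fst (trace k enc dec ans f P ! t)) (fst (snd (trace k enc dec ans f P ! t)))
      else Halt (Some (outcome (responder k enc dec ans f) P)))"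
proof (induction P arbitrary: t)
  case (Ret x)
  show ?case by (simp add: trace_def compiled_step_def)
next
  case (Ask j q c)
  show ?case
  proof (cases t)
    case 0
    then show ?thesis by (simp add: trace_def compiled_step_def)
  next
    case (Suc t')
    let ?y = "responder k enc dec ans f j q"
    have trace: "trace k enc dec ans f (Ask j q c) =
        (j mod k, enc q, enc (ans (f (j mod k)) (dec (enc q)))) # trace k enc dec ans f (c ?y)"
      by (simp add: trace_def)
    have "compiled_step k enc dec (Ask j q c) (take t (trace k enc dec ans f (Ask j q c))) =
        compiled_step k enc dec (c ?y) (take t' (trace k enc dec ans f (c ?y)))"
      by (simp add: trace Suc compiled_step_def responder_def)
    then show ?thesis
      using Ask.IH[of "c ?y" t', OF rangeI] by (simp add: trace Suc)
  qed
qed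

lemma run_compiled:
  fixes R :: "'w pmf"
  assumes "\<omega> \<in> set_pmf R"
  shows "run (compiled k enc dec ans R pr) f (to_nat_on (set_pmf R) \<omega>) s t =
           take t (trace k enc dec ans f (pr \<omega>))"
proof (induction t)
  case (Suc t)
  have [simp]: "from_nat_into (set_pmf R) (to_nat_on (set_pmf R) \<omega>) = \<omega>"
    using assms by (simp add: countable_set_pmf)
  let ?T = "trace k enc dec ans f (pr \<omega>)"
  have step: "coord_step (compiled k enc dec ans R pr) (to_nat_on (set_pmf R) \<omega>) (take t ?T) =
     (if t < length ?T then Query (fst (?T ! t)) (fst (snd (?T ! t)))
      else Halt (Some (outcome (responder k enc dec ans f) (pr \<omega>))))"
    by (simp add: compiled_def compiled_step_trace)
  show ?case
  proof (cases "t < length ?T")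
    case True
    then have "?T ! t = (fst (?T ! t), fst (snd (?T ! t)),
        enc (ans (f (fst (?T ! t))) (dec (fst (snd (?T ! t))))))"
      by (auto simp: trace_def case_prod_beta)
    with True step Suc show ?thesis
      by (simp add: Let_def take_Suc_conv_app_nth) (simp add: compiled_def)
  next
    case False
    with step Suc show ?thesis by (simp add: Let_def)
  qed
qed simp

lemma result_compiled:
  fixes R :: "'w pmf"
  assumes "\<omega> \<in> set_pmf R"
  shows "result (compiled k enc dec ans R pr) f (to_nat_on (set_pmf R) \<omega>) s =
           Some (outcome (responder k enc dec ans f) (pr \<omega>))"
proof -
  let ?P = "compiled k enc dec ans R pr" and ?r = "to_nat_on (set_pmf R) \<omega>"
  let ?T = "trace k enc dec ans f (pr \<omega>)"
  have [simp]: "from_nat_into (set_pmf R) ?r = \<omega>"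
    using assms by (simp add: countable_set_pmf)
  have step: "coord_step ?P ?r (run ?P f ?r s t) =
     (if t < length ?T then Query (fst (?T ! t)) (fst (snd (?T ! t)))
      else Halt (Some (outcome (responder k enc dec ans f) (pr \<omega>))))" for t
    unfolding run_compiled[OF assms] by (simp add: compiled_def compiled_step_trace)
  \<comment> \<open>The least halting stage need not be identified, since every halting stage has
    the same output.\<close>
  have "\<exists>v. coord_step ?P ?r
      (run ?P f ?r s (LEAST t. \<exists>v. coord_step ?P ?r (run ?P f ?r s t) = Halt v)) = Halt v"
    by (rule LeastI[where k = "length ?T"]) (simp add: step)
  then show ?thesis
    unfolding result_def by (auto simp: step split: if_splits)
qed

lemma coins_compiled:
  "coins k (compiled k enc dec ans R pr) =
     map_pmf (\<lambda>\<omega>. (to_nat_on (set_pmf R) \<omega>, \<lambda>_. 0)) R"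
  by (simp add: coins_def compiled_def pair_return_pmf2 map_pmf_comp)

lemma result_pmf_compiled:
  "result_pmf k (compiled k enc dec ans R pr) f =
     map_pmf (\<lambda>\<omega>. Some (outcome (responder k enc dec ans f) (pr \<omega>))) R"
  unfolding result_pmf_def coins_compiled map_pmf_comp
  by (intro map_pmf_cong refl) (simp add: result_compiled)

text \<open>Every result is a \<open>Some\<close>, so conditioning on success changes
  nothing.\<close>

lemma estimate_pmf_eq:
  assumes "result_pmf k P f = map_pmf (\<lambda>\<omega>. Some (g \<omega>)) R"
  shows "estimate_pmf k P f = map_pmf g R"
    and "measure_pmf.prob (result_pmf k P f) (range Some) = 1"
proof -
  show prob: "measure_pmf.prob (result_pmf k P f) (range Some) = 1"
    unfolding assms measure_map_pmf by (simp add: vimage_def)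
  have ne: "set_pmf (result_pmf k P f) \<inter> range Some \<noteq> {}"
    unfolding assms set_map_pmf using set_pmf_not_empty[of R] by blast
  have "cond_pmf (result_pmf k P f) (range Some) = result_pmf k P f"
  proof (rule pmf_eqI)
    fix x
    show "pmf (cond_pmf (result_pmf k P f) (range Some)) x = pmf (result_pmf k P f) x"
    proof (cases "x \<in> range Some")
      case False
      then have "x \<notin> set_pmf (result_pmf k P f)"
        unfolding assms set_map_pmf by blast
      with False show ?thesis
        unfolding pmf_cond[OF ne] by (simp add: set_pmf_iff)
    qed (simp only: pmf_cond[OF ne] prob if_True div_by_1)
  qed
  then show "estimate_pmf k P f = map_pmf g R"
    by (simp add: estimate_pmf_def assms map_pmf_comp)
qed

lemma uses_at_most_compiled:
  assumes "\<And>x. length (enc x) = l"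
    and "\<And>\<omega>. length (queries (responder k enc dec ans f) (pr \<omega>)) \<le> N"
    and "real (2 * l * N) \<le> B"
  shows "uses_at_most k (compiled k enc dec ans R pr) f B"
  unfolding uses_at_most_def
proof (safe)
  fix r s t
  assume "(r, s) \<in> set_pmf (coins k (compiled k enc dec ans R pr))"
  then obtain \<omega> where w: "\<omega> \<in> set_pmf R" "r = to_nat_on (set_pmf R) \<omega>"
    by (auto simp: coins_compiled)
  let ?T = "trace k enc dec ans f (pr \<omega>)"
  have "bits xs = 2 * l * length xs" if "set xs \<subseteq> set ?T" for xs
    using that by (induction xs) (auto simp: bits_def trace_def assms(1))
  then have "bits (run (compiled k enc dec ans R pr) f r s t) = 2 * l * length (take t ?T)"
    by (simp add: w run_compiled set_take_subset)
  also have "\<dots> \<le> 2 * l * N"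
    using assms(2)[of \<omega>] by (intro mult_left_mono) (auto simp: trace_def)
  finally show "real (bits (run (compiled k enc dec ans R pr) f r s t)) \<le> B"
    using assms(3) by linarith
qed

section \<open>Batches of queries, sums of subroutines, and a fixed-length code\<close>

primrec asks :: "(nat \<times> nat) list \<Rightarrow> (nat list \<Rightarrow> prog) \<Rightarrow> prog" where
  "asks [] c = c []"
| "asks (x # xs) c = Ask (fst x) (snd x) (\<lambda>y. asks xs (\<lambda>ys. c (y # ys)))"

lemma outcome_asks:
  "outcome orc (asks xs c) = outcome orc (c (map (\<lambda>(j, q). orc j q) xs))"
  by (induction xs arbitrary: c) (auto simp: case_prod_beta)

lemma length_queries_asks:
  "length (queries orc (asks xs c)) =
     length xs + length (queries orc (c (map (\<lambda>(j, q). orc j q) xs)))"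
  by (induction xs arbitrary: c) (auto simp: case_prod_beta)

text \<open>\<open>B b\<close> is a subroutine in continuation-passing style: it hands its value to
  the program that follows.\<close>

primrec sum_progs :: "(nat \<Rightarrow> (real \<Rightarrow> prog) \<Rightarrow> prog) \<Rightarrow> nat \<Rightarrow> (real \<Rightarrow> prog) \<Rightarrow> prog" where
  "sum_progs B 0 c = c 0"
| "sum_progs B (Suc m) c = sum_progs B m (\<lambda>s. B m (\<lambda>y. c (s + y)))"

lemma outcome_sum_progs:
  assumes "\<And>b c. outcome orc (B b c) = outcome orc (c (y b))"
  shows "outcome orc (sum_progs B m c) = outcome orc (c (\<Sum>b<m. y b))"
  by (induction m arbitrary: c) (auto simp: assms)

lemma length_queries_sum_progs:
  assumes "\<And>b c. length (queries orc (B b c)) = N + length (queries orc (c (y b)))"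
  shows "length (queries orc (sum_progs B m c)) = m * N + length (queries orc (c (\<Sum>b<m. y b)))"
  by (induction m arbitrary: c) (auto simp: assms)

lemma fixed_length_code_exists:
  "\<exists>enc :: nat \<Rightarrow> message. \<exists>dec. (\<forall>x<2 ^ l. dec (enc x) = x) \<and> (\<forall>x. length (enc x) = l)"
proof -
  let ?A = "{xs :: bool list. length xs = l}"
  have "card ?A = 2 ^ l"
    using card_lists_length_eq[of "UNIV :: bool set" l] by simp
  moreover have "finite ?A"
    using finite_lists_length_eq[of "UNIV :: bool set" l] by simp
  ultimately obtain h where h: "bij_betw h {..<(2::nat) ^ l} ?A"
    by (metis card_lessThan finite_lessThan finite_same_card_bij)
  \<comment> \<open>The reduction gives messages of length \<open>l\<close> to numbers out of range
    too, as validity and worst-case cost demand.\<close>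
  define enc where "enc x = h (x mod 2 ^ l)" for x
  have "length (enc x) = l" for x
    using bij_betw_apply[OF h, of "x mod 2 ^ l"] by (simp add: enc_def)
  moreover have "inv_into {..<2 ^ l} h (enc x) = x" if "x < 2 ^ l" for x
    using that bij_betw_inv_into_left[OF h, of x] by (simp add: enc_def)
  ultimately show ?thesis by blast
qed

section \<open>Sampling by weights\<close>

text \<open>Cuts \<open>[0, sum_list ss)\<close> into consecutive intervals of lengths \<open>ss\<close> and returns the index of
  the interval containing \<open>v\<close> with the offset of \<open>v\<close> in it.\<close>

fun locate :: "nat list \<Rightarrow> nat \<Rightarrow> nat \<times> nat" where
  "locate [] v = (0, v)"
| "locate (s # ss) v = (if v < s then (0, v) else apfst Suc (locate ss (v - s)))"

lemma locate_bounds: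
  assumes "v < sum_list ss"
  shows "fst (locate ss v) < length ss" "snd (locate ss v) < ss ! fst (locate ss v)"
proof -
  have "fst (locate ss v) < length ss \<and> snd (locate ss v) < ss ! fst (locate ss v)"
    using assms by (induction ss v rule: locate.induct) auto
  then show "fst (locate ss v) < length ss" "snd (locate ss v) < ss ! fst (locate ss v)"
    by auto
qed

lemma sum_lessThan_add:
  fixes g :: "nat \<Rightarrow> 'a::comm_monoid_add"
  shows "(\<Sum>v<s + t. g v) = (\<Sum>v<s. g v) + (\<Sum>v<t. g (s + v))"
  by (induction t) (auto simp: add.assoc)

text \<open>Below \<open>sum_list ss\<close>, \<open>locate\<close> is a bijection onto the pairs of
  an index and an offset in its interval; a uniform argument thus picks an index with probability
  proportional to its length.\<close>

lemma sum_locate: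
  fixes g :: "nat \<times> nat \<Rightarrow> 'a::comm_monoid_add"
  shows "(\<Sum>v<sum_list ss. g (locate ss v)) = (\<Sum>j<length ss. \<Sum>x<ss ! j. g (j, x))"
proof (induction ss arbitrary: g)
  case (Cons s ss)
  have "(\<Sum>v<sum_list ss. g (locate (s # ss) (s + v))) =
      (\<Sum>v<sum_list ss. (g \<circ> apfst Suc) (locate ss v))"
    by simp
  also have "\<dots> = (\<Sum>j<length ss. \<Sum>x<ss ! j. (g \<circ> apfst Suc) (j, x))"
    by (rule Cons.IH)
  finally have "(\<Sum>v<sum_list ss. g (locate (s # ss) (s + v))) =
      (\<Sum>j<length ss. \<Sum>x<ss ! j. g (Suc j, x))"
    by simp
  moreover have "(\<Sum>v<s. g (locate (s # ss) v)) = (\<Sum>v<s. g (0, v))"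
    by (intro sum.cong) auto
  ultimately show ?case
    by (simp only: sum_list.Cons sum_lessThan_add)
      (simp only: length_Cons sum.lessThan_Suc_shift nth_Cons_0 nth_Cons_Suc)
qed simp

lemma sum_mod:
  fixes g :: "nat \<Rightarrow> real"
  shows "(\<Sum>u<q * s. g (u mod s)) = real q * (\<Sum>v<s. g v)"
proof (induction q)
  case (Suc q)
  have "(\<Sum>u<Suc q * s. g (u mod s)) =
      (\<Sum>u<q * s. g (u mod s)) + (\<Sum>v<s. g ((q * s + v) mod s))"
    using sum_lessThan_add[of "\<lambda>u. g (u mod s)" "q * s" s] by (simp add: add.commute)
  also have "(\<Sum>v<s. g ((q * s + v) mod s)) = (\<Sum>v<s. g v)"
    by (intro sum.cong) auto
  finally show ?case by (simp add: Suc algebra_simps)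
qed simp

text \<open>Reduction modulo a divisor of \<open>L\<close> keeps a uniform number uniform, so
  sampling below \<open>s\<close> is exact.\<close>

lemma expectation_mod:
  fixes g :: "nat \<Rightarrow> real"
  assumes "s dvd L" "L > 0"
  shows "measure_pmf.expectation (pmf_of_set {..<L}) (\<lambda>u. g (u mod s)) = (\<Sum>v<s. g v) / real s"
proof -
  obtain q where L: "L = q * s" using assms by (metis dvdE mult.commute)
  have "measure_pmf.expectation (pmf_of_set {..<L}) (\<lambda>u. g (u mod s)) =
      (\<Sum>u<L. g (u mod s)) / real L"
    using assms by (subst integral_pmf_of_set) auto
  also have "\<dots> = (\<Sum>v<s. g v) / real s"
    using assms unfolding L sum_mod by auto
  finally show ?thesis .
qed

section \<open>Moments under independent coins\<close>

lemma expectation_pair_pmf: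
  fixes h :: "'a \<times> 'b \<Rightarrow> real"
  assumes "finite (set_pmf P)" "finite (set_pmf R)"
  shows "measure_pmf.expectation (pair_pmf P R) h =
    measure_pmf.expectation P (\<lambda>x. measure_pmf.expectation R (\<lambda>y. h (x, y)))"
proof -
  have "measure_pmf.expectation (pair_pmf P R) h =
      (\<Sum>a\<in>set_pmf P. pmf P a *\<^sub>R
         measure_pmf.expectation (R \<bind> (\<lambda>y. return_pmf (a, y))) h)"
    unfolding pair_pmf_def using assms by (intro pmf_expectation_bind) auto
  also have "\<dots> = (\<Sum>a\<in>set_pmf P. pmf P a *\<^sub>R measure_pmf.expectation R (\<lambda>y. h (a, y)))"
    by (simp add: map_pmf_def[symmetric])
  also have "\<dots> = measure_pmf.expectation P (\<lambda>x. measure_pmf.expectation R (\<lambda>y. h (x, y)))"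
    using assms by (intro integral_measure_pmf[symmetric]) auto
  finally show ?thesis .
qed

lemma finite_set_Pi_pmf:
  assumes "finite I" "\<And>i. i \<in> I \<Longrightarrow> finite (set_pmf (D i))"
  shows "finite (set_pmf (Pi_pmf I d D))"
  using assms by (simp add: set_Pi_pmf finite_PiE_dflt)

lemma expectation_Pi_pmf_component:
  fixes \<phi> :: "'b \<Rightarrow> real"
  assumes "finite I" "i \<in> I"
  shows "measure_pmf.expectation (Pi_pmf I d D) (\<lambda>U. \<phi> (U i)) = measure_pmf.expectation (D i) \<phi>"
proof -
  have "measure_pmf.expectation (Pi_pmf I d D) (\<lambda>U. \<phi> (U i)) =
      measure_pmf.expectation (map_pmf (\<lambda>U. U i) (Pi_pmf I d D)) \<phi>"
    by simp
  then show ?thesis using assms by (simp add: Pi_pmf_component del: integral_map_pmf)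
qed

text \<open>The product formula for expectations, with the constant 1 in all other
  coordinates.\<close>

lemma expectation_Pi_pmf_two_components:
  fixes \<phi> \<psi> :: "'b \<Rightarrow> real"
  assumes "finite I" "s \<in> I" "t \<in> I" "s \<noteq> t"
    and "\<And>i. i \<in> I \<Longrightarrow> finite (set_pmf (D i))"
    and "\<And>x. \<phi> x \<ge> 0" "\<And>x. \<psi> x \<ge> 0"
  shows "measure_pmf.expectation (Pi_pmf I d D) (\<lambda>U. \<phi> (U s) * \<psi> (U t)) =
    measure_pmf.expectation (D s) \<phi> * measure_pmf.expectation (D t) \<psi>"
proof -
  define F where "F i = (if i = s then \<phi> else if i = t then \<psi> else (\<lambda>_. 1))" for i
  have two: "(\<Prod>i\<in>I. G i) = G s * G t" if "\<And>i. i \<noteq> s \<Longrightarrow> i \<noteq> t \<Longrightarrow> G i = 1" for G :: "'a \<Rightarrow> real"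
  proof -
    have "(\<Prod>i\<in>I. G i) = (\<Prod>i\<in>{s, t}. G i)"
      using assms that by (intro prod.mono_neutral_right) auto
    then show ?thesis using assms by simp
  qed
  have "measure_pmf.expectation (Pi_pmf I d D) (\<lambda>U. \<Prod>i\<in>I. F i (U i)) =
      (\<Prod>i\<in>I. measure_pmf.expectation (D i) (F i))"
    using assms
    by (intro expectation_prod_Pi_pmf integrable_measure_pmf_finite) (auto simp: F_def)
  moreover have "(\<lambda>U. \<Prod>i\<in>I. F i (U i)) = (\<lambda>U. \<phi> (U s) * \<psi> (U t))"
    using assms by (subst two) (auto simp: F_def)
  moreover have "(\<Prod>i\<in>I. measure_pmf.expectation (D i) (F i)) =
      measure_pmf.expectation (D s) \<phi> * measure_pmf.expectation (D t) \<psi>"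
    using assms by (subst two) (auto simp: F_def)
  ultimately show ?thesis by simp
qed

text \<open>In the expanded square, independence turns each off-diagonal pair into the squared mean,
  while the \<open>m\<close> diagonal pairs give the second moment. Granting the diagonal an extra
  squared mean makes the bound a plain sum.\<close>

lemma iid_average_moments:
  fixes Y :: "'b \<Rightarrow> real"
  assumes "m \<ge> 1" "finite (set_pmf Q)" "\<And>x. Y x \<ge> 0"
  shows "measure_pmf.expectation (Pi_pmf {..<m} d (\<lambda>_. Q)) (\<lambda>\<omega>. (\<Sum>b<m. Y (\<omega> b)) / real m) =
      measure_pmf.expectation Q Y"
    and "measure_pmf.expectation (Pi_pmf {..<m} d (\<lambda>_. Q)) (\<lambda>\<omega>. ((\<Sum>b<m. Y (\<omega> b)) / real m)\<^sup>2) \<le>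
      (measure_pmf.expectation Q Y)\<^sup>2 + measure_pmf.expectation Q (\<lambda>x. (Y x)\<^sup>2) / real m"
proof -
  let ?P = "Pi_pmf {..<m} d (\<lambda>_. Q)"
  let ?E = "measure_pmf.expectation ?P" and ?EQ = "measure_pmf.expectation Q"
  have int [simp, intro]: "integrable (measure_pmf ?P) h" for h :: "(nat \<Rightarrow> 'b) \<Rightarrow> real"
    using assms by (intro integrable_measure_pmf_finite finite_set_Pi_pmf) auto
  have one: "?E (\<lambda>\<omega>. \<phi> (\<omega> b)) = ?EQ \<phi>" if "b < m" for b and \<phi> :: "'b \<Rightarrow> real"
    using that by (intro expectation_Pi_pmf_component) auto
  show "?E (\<lambda>\<omega>. (\<Sum>b<m. Y (\<omega> b)) / real m) = ?EQ Y"
    using assms by (simp add: one)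
  have "?E (\<lambda>\<omega>. ((\<Sum>b<m. Y (\<omega> b)) / real m)\<^sup>2) =
      ?E (\<lambda>\<omega>. (\<Sum>a<m. \<Sum>b<m. Y (\<omega> a) * Y (\<omega> b)) / (real m)\<^sup>2)"
    by (simp add: power_divide power2_eq_square sum_product)
  also have "\<dots> = (\<Sum>a<m. \<Sum>b<m. ?E (\<lambda>\<omega>. Y (\<omega> a) * Y (\<omega> b))) / (real m)\<^sup>2"
    by simp
  also have "(\<Sum>a<m. \<Sum>b<m. ?E (\<lambda>\<omega>. Y (\<omega> a) * Y (\<omega> b))) \<le>
      (\<Sum>a<m. \<Sum>b<m. (?EQ Y)\<^sup>2 + (if a = b then ?EQ (\<lambda>x. (Y x)\<^sup>2) else 0))"
  proof (intro sum_mono)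
    fix a b assume ab: "a \<in> {..<m}" "b \<in> {..<m}"
    show "?E (\<lambda>\<omega>. Y (\<omega> a) * Y (\<omega> b)) \<le>
        (?EQ Y)\<^sup>2 + (if a = b then ?EQ (\<lambda>x. (Y x)\<^sup>2) else 0)"
    proof (cases "a = b")
      case True
      then show ?thesis
        using ab one[of b "\<lambda>x. (Y x)\<^sup>2"] by (simp add: power2_eq_square)
    next
      case False
      then show ?thesis
        using ab assms
        by (simp add: expectation_Pi_pmf_two_components power2_eq_square)
    qed
  qed
  also have "(\<Sum>a<m. \<Sum>b<m. (?EQ Y)\<^sup>2 + (if a = b then ?EQ (\<lambda>x. (Y x)\<^sup>2) else 0)) =
      (real m)\<^sup>2 * (?EQ Y)\<^sup>2 + real m * ?EQ (\<lambda>x. (Y x)\<^sup>2)"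
    by (simp add: sum.distrib power2_eq_square algebra_simps)
  also have "\<dots> / (real m)\<^sup>2 = (?EQ Y)\<^sup>2 + ?EQ (\<lambda>x. (Y x)\<^sup>2) / real m"
    using assms(1) by (simp add: field_simps power2_eq_square)
  finally show "?E (\<lambda>\<omega>. ((\<Sum>b<m. Y (\<omega> b)) / real m)\<^sup>2) \<le>
      (?EQ Y)\<^sup>2 + ?EQ (\<lambda>x. (Y x)\<^sup>2) / real m"
    by (simp add: divide_right_mono)
qed

text \<open>A single uniform coin below a common multiple \<open>L\<close> of all possible totals, reduced modulo the
  actual total, realizes the choice of a draw proportionally to its weight exactly.\<close>

lemma resampling_moments:
  fixes wt :: "nat \<Rightarrow> nat \<Rightarrow> nat" and g :: "nat \<Rightarrow> real"
  assumes "L > 0" "M > 0" "\<And>u. g u \<ge> 0" "\<And>t u. wt t u \<le> M"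
    and dvd: "\<And>T. T > 0 \<Longrightarrow> T \<le> k * M \<Longrightarrow> T dvd L"
  defines "uni \<equiv> pmf_of_set {..<L}"
  defines "ws \<equiv> \<lambda>U. map (\<lambda>t. wt t (U t)) [0..<k]"
  defines "Y \<equiv> \<lambda>(U, V). real (sum_list (ws U)) / real M *
    g (U (fst (locate (ws U) (V mod sum_list (ws U)))))"
  defines "Q \<equiv> pair_pmf (Pi_pmf {..<k} 0 (\<lambda>_. uni)) uni"
  shows "measure_pmf.expectation Q Y =
      (\<Sum>t<k. measure_pmf.expectation uni (\<lambda>u. real (wt t u) / real M * g u))"
    and "measure_pmf.expectation Q (\<lambda>x. (Y x)\<^sup>2) \<le>
      (1 + (\<Sum>t<k. measure_pmf.expectation uni (\<lambda>u. real (wt t u) / real M))) *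
      (\<Sum>t<k. measure_pmf.expectation uni (\<lambda>u. real (wt t u) / real M * (g u)\<^sup>2))"
proof -
  let ?P = "Pi_pmf {..<k} 0 (\<lambda>_. uni)"
  let ?E = "measure_pmf.expectation ?P" and ?Eu = "measure_pmf.expectation uni"
  have fin_uni: "finite (set_pmf uni)"
    using \<open>L > 0\<close> unfolding uni_def by (subst set_pmf_of_set) auto
  have fin_P: "finite (set_pmf ?P)"
    by (intro finite_set_Pi_pmf) (auto simp: fin_uni)
  have int [simp, intro]: "integrable (measure_pmf ?P) h" for h :: "(nat \<Rightarrow> nat) \<Rightarrow> real"
    by (intro integrable_measure_pmf_finite fin_P)
  have int' [simp, intro]: "integrable (measure_pmf uni) h" for h :: "nat \<Rightarrow> real"
    by (intro integrable_measure_pmf_finite fin_uni)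
  have one: "?E (\<lambda>U. \<phi> (U t)) = ?Eu \<phi>" if "t < k" for t and \<phi> :: "nat \<Rightarrow> real"
    using that by (intro expectation_Pi_pmf_component) auto
  have sum_ws: "sum_list (ws U) = (\<Sum>t<k. wt t (U t))" for U
    by (simp add: ws_def interv_sum_list_conv_sum_set_nat atLeast0LessThan)
  \<comment> \<open>Averaging over the selecting coin cancels the normalization: total score times
    mean value is the score-weighted sum, also when all scores vanish.\<close>
  have select: "real (sum_list (ws U)) *
      ?Eu (\<lambda>V. h (fst (locate (ws U) (V mod sum_list (ws U))))) = (\<Sum>t<k. real (wt t (U t)) * h t)"
    for U and h :: "nat \<Rightarrow> real"
  proof (cases "sum_list (ws U) = 0")
    case True
    then have "\<forall>t<k. wt t (U t) = 0" by (simp add: sum_ws)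
    with True show ?thesis by simp
  next
    case False
    have "sum_list (ws U) \<le> (\<Sum>t<k. M)"
      unfolding sum_ws by (intro sum_mono assms)
    then have "sum_list (ws U) dvd L" using False by (intro dvd) (simp_all del: sum_list_eq_0_iff)
    from expectation_mod[OF this \<open>L > 0\<close>, of "\<lambda>v. h (fst (locate (ws U) v))"]
    have "?Eu (\<lambda>V. h (fst (locate (ws U) (V mod sum_list (ws U))))) =
        (\<Sum>v<sum_list (ws U). h (fst (locate (ws U) v))) / real (sum_list (ws U))"
      by (simp add: uni_def)
    also have "(\<Sum>v<sum_list (ws U). h (fst (locate (ws U) v))) =
        (\<Sum>t<k. real (wt t (U t)) * h t)"
      using sum_locate[of "\<lambda>x. h (fst x)" "ws U"] by (simp add: ws_def)
    finally show ?thesis using False by simp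
  qed
  have "measure_pmf.expectation Q Y = ?E (\<lambda>U. ?Eu (\<lambda>V. Y (U, V)))"
    unfolding Q_def by (rule expectation_pair_pmf[OF fin_P fin_uni])
  also have "\<dots> = ?E (\<lambda>U. \<Sum>t<k. real (wt t (U t)) / real M * g (U t))"
  proof -
    have "?Eu (\<lambda>V. Y (U, V)) = (\<Sum>t<k. real (wt t (U t)) / real M * g (U t))" for U
    proof -
      have "?Eu (\<lambda>V. Y (U, V)) = real (sum_list (ws U)) / real M *
          ?Eu (\<lambda>V. g (U (fst (locate (ws U) (V mod sum_list (ws U))))))"
        by (simp add: Y_def)
      also have "\<dots> = (\<Sum>t<k. real (wt t (U t)) * g (U t)) / real M"
        using select[of U "\<lambda>t. g (U t)"] by (simp only: times_divide_eq_left)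
      finally show ?thesis by (simp add: sum_divide_distrib)
    qed
    then show ?thesis by simp
  qed
  also have "\<dots> = (\<Sum>t<k. ?E (\<lambda>U. real (wt t (U t)) / real M * g (U t)))"
    by (intro Bochner_Integration.integral_sum int)
  also have "\<dots> = (\<Sum>t<k. ?Eu (\<lambda>u. real (wt t u) / real M * g u))"
    by (intro sum.cong refl one) auto
  finally show "measure_pmf.expectation Q Y =
      (\<Sum>t<k. ?Eu (\<lambda>u. real (wt t u) / real M * g u))" .

  define a where "a t u = real (wt t u) / real M" for t u
  define c where "c t u = a t u * (g u)\<^sup>2" for t u
  have a_bounds: "0 \<le> a t u" "a t u \<le> 1" for t u
    using assms(2) assms(4)[of t u] by (auto simp: a_def)
  have c_nonneg: "0 \<le> c t u" for t u
    using a_bounds by (simp add: c_def)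
  have "measure_pmf.expectation Q (\<lambda>x. (Y x)\<^sup>2) = ?E (\<lambda>U. ?Eu (\<lambda>V. (Y (U, V))\<^sup>2))"
    unfolding Q_def by (rule expectation_pair_pmf[OF fin_P fin_uni])
  also have "\<dots> = ?E (\<lambda>U. \<Sum>s<k. \<Sum>t<k. a s (U s) * c t (U t))"
  proof -
    have "?Eu (\<lambda>V. (Y (U, V))\<^sup>2) = (\<Sum>s<k. \<Sum>t<k. a s (U s) * c t (U t))" for U
    proof -
      have "?Eu (\<lambda>V. (Y (U, V))\<^sup>2) = (real (sum_list (ws U)) / real M)\<^sup>2 *
          ?Eu (\<lambda>V. (g (U (fst (locate (ws U) (V mod sum_list (ws U))))))\<^sup>2)"
        unfolding Y_def prod.case power_mult_distrib by simp
      also have "\<dots> = real (sum_list (ws U)) / (real M)\<^sup>2 * (real (sum_list (ws U)) *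
          ?Eu (\<lambda>V. (g (U (fst (locate (ws U) (V mod sum_list (ws U))))))\<^sup>2))"
        by (simp add: power2_eq_square)
      also have "\<dots> = real (sum_list (ws U)) / (real M)\<^sup>2 *
          (\<Sum>t<k. real (wt t (U t)) * (g (U t))\<^sup>2)"
        by (simp only: select[of U "\<lambda>t. (g (U t))\<^sup>2"])
      also have "\<dots> = (\<Sum>s<k. a s (U s)) * (\<Sum>t<k. c t (U t))"
        by (simp add: sum_ws a_def c_def sum_divide_distrib[symmetric] power2_eq_square)
      finally show ?thesis by (simp add: sum_product)
    qed
    then show ?thesis by simp
  qed
  also have "\<dots> = (\<Sum>s<k. \<Sum>t<k. ?E (\<lambda>U. a s (U s) * c t (U t)))"
    by simp
  \<comment> \<open>On the diagonal the factor \<open>a\<close>, at most 1, is dropped, which is the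
    source of the summand 1 in the bound. Off the diagonal, independence factors the
    expectation.\<close>
  also have "\<dots> \<le> (\<Sum>s<k. \<Sum>t<k. (if s = t then ?Eu (c t) else 0) + ?Eu (a s) * ?Eu (c t))"
  proof (intro sum_mono)
    fix s t assume st: "s \<in> {..<k}" "t \<in> {..<k}"
    show "?E (\<lambda>U. a s (U s) * c t (U t)) \<le>
        (if s = t then ?Eu (c t) else 0) + ?Eu (a s) * ?Eu (c t)"
    proof (cases "s = t")
      case True
      have "?E (\<lambda>U. a s (U s) * c t (U t)) \<le> ?E (\<lambda>U. c t (U t))"
        using a_bounds c_nonneg by (intro integral_mono int mult_left_le_one_le) auto
      moreover have "?Eu (a s) * ?Eu (c t) \<ge> 0"
        using a_bounds c_nonneg by (intro mult_nonneg_nonneg Bochner_Integration.integral_nonneg)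
      ultimately show ?thesis
        using True st one[of t "c t"] by simp
    next
      case False
      then show ?thesis
        using st a_bounds c_nonneg fin_uni
        by (simp add: expectation_Pi_pmf_two_components)
    qed
  qed
  also have "\<dots> = (1 + (\<Sum>t<k. ?Eu (a t))) * (\<Sum>t<k. ?Eu (c t))"
    by (simp add: sum.distrib sum_product[symmetric] algebra_simps)
  finally show "measure_pmf.expectation Q (\<lambda>x. (Y x)\<^sup>2) \<le>
      (1 + (\<Sum>t<k. ?Eu (\<lambda>u. real (wt t u) / real M))) *
      (\<Sum>t<k. ?Eu (\<lambda>u. real (wt t u) / real M * (g u)\<^sup>2))"
    by (simp add: a_def[abs_def] c_def[abs_def])
qed

section \<open>Weights of entries and mass of a coordinate\<close>

text \<open>Jensen's inequality for \<open>powr s\<close> over the positive entries, whose number is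
  at most \<open>k\<close>.\<close>

lemma sum_powr_le:
  fixes x :: "nat \<Rightarrow> real"
  assumes "s \<ge> 1" "\<And>j. x j \<ge> 0"
  shows "(\<Sum>j<k. x j) powr s \<le> real k powr (s - 1) * (\<Sum>j<k. x j powr s)"
proof -
  define J where "J = {j. j < k \<and> x j > 0}"
  have J: "finite J" "J \<subseteq> {..<k}" by (auto simp: J_def)
  have zero: "x j = 0" if "j \<in> {..<k} - J" for j
    using that assms(2)[of j] by (auto simp: J_def)
  show ?thesis
  proof (cases "J = {}")
    case True
    then have "(\<Sum>j<k. x j) = 0" using zero by simp
    then show ?thesis by (simp add: sum_nonneg)
  next
    case False
    let ?c = "real (card J)"
    have c: "?c > 0" using False J by (simp add: card_gt_0_iff)
    have "(\<Sum>j\<in>J. (1 / ?c) *\<^sub>R x j) powr s \<le> (\<Sum>j\<in>J. (1 / ?c) * (x j powr s))"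
      using False J c assms
      by (intro convex_on_sum[OF _ _ powr_convex]) (auto simp: J_def)
    then have le: "((\<Sum>j\<in>J. x j) / ?c) powr s \<le> (\<Sum>j\<in>J. x j powr s) / ?c"
      by (simp add: sum_divide_distrib[symmetric])
    have "(\<Sum>j<k. x j) powr s = (\<Sum>j\<in>J. x j) powr s"
      using J zero by (subst sum.mono_neutral_right[of "{..<k}" J]) auto
    also have "\<dots> = ?c powr s * ((\<Sum>j\<in>J. x j) / ?c) powr s"
      using c assms(2) by (subst powr_mult[symmetric]) (auto intro: sum_nonneg)
    also have "\<dots> \<le> ?c powr s * ((\<Sum>j\<in>J. x j powr s) / ?c)"
      by (intro mult_left_mono le) auto
    also have "\<dots> = ?c powr (s - 1) * (\<Sum>j\<in>J. x j powr s)"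
      using c by (simp add: powr_diff)
    also have "\<dots> \<le> real k powr (s - 1) * (\<Sum>j\<in>J. x j powr s)"
      using assms card_mono[OF _ J(2)] by (intro mult_right_mono powr_mono2 sum_nonneg) auto
    also have "(\<Sum>j\<in>J. x j powr s) = (\<Sum>j<k. x j powr s)"
      using J zero by (intro sum.mono_neutral_left) auto
    finally show ?thesis .
  qed
qed

definition weight :: "real \<Rightarrow> nat \<Rightarrow> nat" where
  "weight p x = nat \<lfloor>real x powr p\<rfloor>"

lemma weight_le: "real (weight p x) \<le> real x powr p"
  by (simp add: weight_def)

lemma weight_0 [simp]: "weight p 0 = 0"
  by (simp add: weight_def)

text \<open>Powers of nonzero entries are at least 1, and from there on rounding down loses less
  than a factor 2.\<close>

lemma weight_ge:
  assumes "p \<ge> 0"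
  shows "real x powr p \<le> 2 * real (weight p x)"
proof (cases "x = 0")
  case False
  then have 1: "1 \<le> real x powr p"
    using assms by (intro ge_one_powr_ge_zero) auto
  then have "real (weight p x) = of_int \<lfloor>real x powr p\<rfloor>"
    by (simp add: weight_def)
  moreover have "1 \<le> \<lfloor>real x powr p\<rfloor>" using 1 by simp
  ultimately show ?thesis by linarith
qed simp

lemma weight_le_power:
  assumes "p \<ge> 0" "x \<le> N"
  shows "weight p x \<le> N ^ nat \<lceil>p\<rceil>"
proof (cases "x = 0")
  case False
  have "real x powr p \<le> real x powr real (nat \<lceil>p\<rceil>)"
    using False assms by (intro powr_mono real_nat_ceiling_ge) auto
  also have "\<dots> = real x ^ nat \<lceil>p\<rceil>"
    using False by (simp add: powr_realpow)
  also have "\<dots> \<le> real N ^ nat \<lceil>p\<rceil>"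
    using assms by (intro power_mono) auto
  finally have "real (weight p x) \<le> real (N ^ nat \<lceil>p\<rceil>)"
    unfolding of_nat_power using weight_le[of p x] by linarith
  then show ?thesis by (simp only: of_nat_le_iff)
qed simp

text \<open>This is the \<open>A\<^sub>i\<close> of the overview for
  \<open>x j = f\<^sub>i(j)\<close>. Terms with \<open>x j = 0\<close> vanish, so the division by
  zero is harmless.\<close>

definition mass :: "real \<Rightarrow> nat \<Rightarrow> (nat \<Rightarrow> nat) \<Rightarrow> real" where
  "mass p k x =
     (\<Sum>j<k. \<Sum>t<k. real (weight p (x j)) * (real (min (x j) (x t)) / real (x j)))"

text \<open>The terms with \<open>t = j\<close> have ratio 1 whenever the weight is nonzero.\<close>

lemma mass_ge_weights: "(\<Sum>j<k. real (weight p (x j))) \<le> mass p k x"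
  unfolding mass_def
proof (intro sum_mono)
  fix j assume j: "j \<in> {..<k}"
  have "real (weight p (x j)) = real (weight p (x j)) * (real (min (x j) (x j)) / real (x j))"
    by (cases "x j = 0") auto
  also have "\<dots> \<le> (\<Sum>t<k. real (weight p (x j)) * (real (min (x j) (x t)) / real (x j)))"
    using j by (intro member_le_sum) auto
  finally show "real (weight p (x j)) \<le>
      (\<Sum>t<k. real (weight p (x j)) * (real (min (x j) (x t)) / real (x j)))" .
qed

text \<open>With \<open>s\<close> the sum of the entries, a term is at most
  \<open>x j powr (p - 1) * x t\<close>, hence at most \<open>x j * s powr (p - 2) * x t\<close>;
  these bounds sum to \<open>s powr p\<close>.\<close>

lemma mass_le:
  assumes "p \<ge> 2"
  shows "mass p k x \<le> real (\<Sum>j<k. x j) powr p"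
proof -
  let ?s = "real (\<Sum>j<k. x j)"
  have "mass p k x \<le> (\<Sum>j<k. \<Sum>t<k. real (x j) * ?s powr (p - 2) * real (x t))"
    unfolding mass_def
  proof (intro sum_mono)
    fix j t assume j: "j \<in> {..<k}"
    show "real (weight p (x j)) * (real (min (x j) (x t)) / real (x j)) \<le>
        real (x j) * ?s powr (p - 2) * real (x t)"
    proof (cases "x j = 0")
      case False
      have "x j \<le> (\<Sum>j<k. x j)" using j by (intro member_le_sum) auto
      then have "real (x j) \<le> ?s" by (simp only: of_nat_le_iff)
      have "real (weight p (x j)) * (real (min (x j) (x t)) / real (x j)) \<le>
          real (x j) powr p * (real (x t) / real (x j))"
        by (intro mult_mono weight_le divide_right_mono) auto
      also have "\<dots> = real (x j) * real (x j) powr (p - 2) * real (x t)"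
        using False by (simp add: powr_diff power2_eq_square)
      also have "\<dots> \<le> real (x j) * ?s powr (p - 2) * real (x t)"
        using assms \<open>real (x j) \<le> ?s\<close>
        by (intro mult_right_mono mult_left_mono powr_mono2) auto
      finally show ?thesis .
    qed simp
  qed
  also have "\<dots> = ?s * ?s powr (p - 2) * ?s"
    by (simp add: sum_distrib_left[symmetric] sum_distrib_right[symmetric])
  also have "\<dots> = ?s powr p"
    by (cases "?s = 0") (auto simp: powr_diff power2_eq_square simp del: of_nat_sum)
  finally show ?thesis .
qed

text \<open>If \<open>b <= a\<close>, the first term on the right is the left side. Otherwise
  \<open>a powr (p - 2) <= b powr (p - 2)\<close> bounds the left side by
  \<open>b powr (p - 1) * a\<close>, which is the second term.\<close>

lemma powr_mult_le_symmetrized: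
  fixes a b :: real
  assumes "p \<ge> 2" "a \<ge> 0" "b \<ge> 0"
  shows "a powr (p - 1) * b \<le> a powr p * (min a b / a) + b powr p * (min b a / b)"
proof (cases "a = 0 \<or> b = 0")
  case False
  then have pos: "a > 0" "b > 0" using assms by auto
  have split: "c powr p = c powr (p - 1) * c" "c powr (p - 1) = c powr (p - 2) * c"
    if "c > 0" for c :: real
    using that by (auto simp: powr_diff power2_eq_square)
  show ?thesis
  proof (cases "b \<le> a")
    case True
    then show ?thesis using pos by (simp add: split(1))
  next
    case 2: False
    then have "a powr (p - 2) \<le> b powr (p - 2)"
      using assms by (intro powr_mono2) auto
    then have "a powr (p - 1) * b \<le> b powr (p - 1) * a"
      using pos by (simp add: split(2))
    also have "\<dots> = b powr p * (min b a / b)"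
      using 2 pos by (simp add: split(1))
    finally show ?thesis using pos by (simp add: add_increasing)
  qed
qed (use assms in auto)

text \<open>The exponent \<open>p - 2\<close> (instead of the \<open>p - 1\<close> of plain power-weighted sampling) is what saves
  the factor \<open>k\<close> in the number of evaluated coordinates.\<close>

lemma powr_sum_le_mass:
  assumes "p \<ge> 2"
  shows "real (\<Sum>j<k. x j) powr p \<le> 4 * real k powr (p - 2) * mass p k x"
proof -
  let ?s = "real (\<Sum>j<k. x j)"
  let ?r = "\<lambda>j t. real (min (x j) (x t)) / real (x j)"
  have "(\<Sum>j<k. real (x j) powr (p - 1)) * ?s =
      (\<Sum>j<k. \<Sum>t<k. real (x j) powr (p - 1) * real (x t))"
    by (simp add: sum_product)
  also have "\<dots> \<le> (\<Sum>j<k. \<Sum>t<k. real (x j) powr p * ?r j t + real (x t) powr p * ?r t j)"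
    using assms powr_mult_le_symmetrized by (intro sum_mono) (simp add: of_nat_min)
  also have "\<dots> = 2 * (\<Sum>j<k. \<Sum>t<k. real (x j) powr p * ?r j t)"
    using sum.swap[of "\<lambda>j t. real (x t) powr p * ?r t j" "{..<k}" "{..<k}"]
    by (simp add: sum.distrib)
  also have "\<dots> \<le> 2 * (\<Sum>j<k. \<Sum>t<k. 2 * real (weight p (x j)) * ?r j t)"
    using assms by (intro mult_left_mono sum_mono mult_right_mono weight_ge) auto
  \<comment> \<open>One factor 2 comes from symmetrizing, the other from rounding the
    weights.\<close>
  also have "\<dots> = 4 * mass p k x"
    by (simp add: mass_def sum_distrib_left mult.assoc)
  finally have sym: "(\<Sum>j<k. real (x j) powr (p - 1)) * ?s \<le> 4 * mass p k x" .
  have "?s powr p = ?s powr (p - 1) * ?s"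
    by (cases "?s = 0") (auto simp: powr_diff simp del: of_nat_sum)
  \<comment> \<open>One factor of the sum is set aside, so the power mean inequality applies with
    exponent \<open>p - 1\<close> and costs only \<open>k powr (p - 2)\<close>.\<close>
  also have "\<dots> \<le> (real k powr (p - 1 - 1) * (\<Sum>j<k. real (x j) powr (p - 1))) * ?s"
    unfolding of_nat_sum using assms
    by (intro mult_right_mono sum_powr_le sum_nonneg) auto
  also have "\<dots> = real k powr (p - 2) * ((\<Sum>j<k. real (x j) powr (p - 1)) * ?s)"
    by simp
  also have "\<dots> \<le> real k powr (p - 2) * (4 * mass p k x)"
    by (intro mult_left_mono sym) auto
  finally show ?thesis by simp
qed

section \<open>The estimator\<close>

text \<open>Query \<open>0\<close> asks a server for its total weight, \<open>2 x + 1\<close> for the coordinate whose weight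
  interval contains the offset \<open>x\<close>, and \<open>2 i + 2\<close> for its \<open>i\<close>-th entry.\<close>

definition answer :: "real \<Rightarrow> nat list \<Rightarrow> nat \<Rightarrow> nat" where
  "answer p v q =
     (if q = 0 then sum_list (map (weight p) v)
      else if odd q then fst (locate (map (weight p) v) (q div 2))
      else v ! (q div 2 - 1))"

text \<open>\<open>Ss\<close> are the total weights of the servers, \<open>fst \<omega> t\<close> is the coin of draw \<open>t\<close> and \<open>snd \<omega>\<close> the
  coin that selects a draw. The ratio \<open>min 1 (z / x)\<close> enters as the integer
  \<open>min x z * (M div x)\<close>, where \<open>M\<close> is a common multiple of all possible \<open>x\<close>. Draws made when all
  weights vanish are junk, but then the returned value is \<open>0\<close>.\<close>

definition block ::
    "real \<Rightarrow> nat \<Rightarrow> nat \<Rightarrow> nat list \<Rightarrow> (nat \<Rightarrow> nat) \<times> nat \<Rightarrow> (real \<Rightarrow> prog) \<Rightarrow> prog" where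
  "block p k M Ss \<omega> c =
     (let js = map (\<lambda>t. locate Ss (fst \<omega> t mod sum_list Ss)) [0..<k] in
      asks (map (\<lambda>t. (fst (js ! t), Suc (2 * snd (js ! t)))) [0..<k]) (\<lambda>is.
      asks (map (\<lambda>t. (fst (js ! t), 2 + 2 * is ! t)) [0..<k]) (\<lambda>xs.
      asks (map (\<lambda>t. (t, 2 + 2 * is ! t)) [0..<k]) (\<lambda>zs.
        let ws = map (\<lambda>t. min (xs ! t) (zs ! t) * (M div xs ! t)) [0..<k];
            i = is ! fst (locate ws (snd \<omega> mod sum_list ws)) in
        asks (map (\<lambda>t. (t, 2 + 2 * i)) [0..<k]) (\<lambda>ys.
          c (real (sum_list ws) / real M *
             (real (sum_list Ss) * real (sum_list ys) powr p / mass p k (\<lambda>j. ys ! j))))))))"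

definition block_value ::
    "real \<Rightarrow> nat \<Rightarrow> nat \<Rightarrow> (nat \<Rightarrow> nat \<Rightarrow> nat) \<Rightarrow> nat list \<Rightarrow> (nat \<Rightarrow> nat) \<times> nat \<Rightarrow> real" where
  "block_value p k M orc Ss \<omega> =
     (let js = map (\<lambda>t. locate Ss (fst \<omega> t mod sum_list Ss)) [0..<k];
          is = map (\<lambda>t. orc (fst (js ! t)) (Suc (2 * snd (js ! t)))) [0..<k];
          xs = map (\<lambda>t. orc (fst (js ! t)) (2 + 2 * is ! t)) [0..<k];
          zs = map (\<lambda>t. orc t (2 + 2 * is ! t)) [0..<k];
          ws = map (\<lambda>t. min (xs ! t) (zs ! t) * (M div xs ! t)) [0..<k];
          i = is ! fst (locate ws (snd \<omega> mod sum_list ws));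
          ys = map (\<lambda>t. orc t (2 + 2 * i)) [0..<k] in
      real (sum_list ws) / real M *
        (real (sum_list Ss) * real (sum_list ys) powr p / mass p k (\<lambda>j. ys ! j)))"

lemma map_queries_upt:
  "map (\<lambda>(j, q). orc j q) (map (\<lambda>t. (a t, b t)) [0..<k]) = map (\<lambda>t. orc (a t) (b t)) [0..<k]"
  by simp

lemma outcome_block:
  "outcome orc (block p k M Ss \<omega> c) = outcome orc (c (block_value p k M orc Ss \<omega>))"
  unfolding block_def block_value_def Let_def outcome_asks map_queries_upt ..

lemma length_queries_block:
  "length (queries orc (block p k M Ss \<omega> c)) =
     4 * k + length (queries orc (c (block_value p k M orc Ss \<omega>)))"
  unfolding block_def block_value_def Let_def length_queries_asks map_queries_upt
  by simp

lemma mass_nonneg: "mass p k x \<ge> 0"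
  unfolding mass_def by (intro sum_nonneg) auto

lemma block_value_nonneg: "block_value p k M orc Ss \<omega> \<ge> 0"
  unfolding block_value_def Let_def by (intro mult_nonneg_nonneg divide_nonneg_nonneg mass_nonneg) auto

lemma block_value_eq_0:
  assumes "sum_list Ss = 0"
  shows "block_value p k M orc Ss \<omega> = 0"
  unfolding block_value_def Let_def
  by (simp only: assms of_nat_0 mult_zero_left div_0 mult_zero_right)

definition estimator ::
    "real \<Rightarrow> nat \<Rightarrow> nat \<Rightarrow> nat \<Rightarrow> (nat \<Rightarrow> (nat \<Rightarrow> nat) \<times> nat) \<Rightarrow> prog" where
  "estimator p k M m \<omega> =
     asks (map (\<lambda>t. (t, 0)) [0..<k])
       (\<lambda>Ss. sum_progs (\<lambda>b. block p k M Ss (\<omega> b)) m (\<lambda>s. Ret (s / real m)))"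

lemma outcome_estimator:
  "outcome orc (estimator p k M m \<omega>) =
     (\<Sum>b<m. block_value p k M orc (map (\<lambda>j. orc j 0) [0..<k]) (\<omega> b)) / real m"
  unfolding estimator_def outcome_asks map_queries_upt
  by (subst outcome_sum_progs[OF outcome_block]) simp

lemma length_queries_estimator:
  "length (queries orc (estimator p k M m \<omega>)) = k + m * (4 * k)"
  unfolding estimator_def length_queries_asks map_queries_upt
  by (subst length_queries_sum_progs[OF length_queries_block]) simp

section \<open>First and second moment of one block\<close>

lemma real_scaled_ratio:
  assumes "x \<le> B"
  shows "real (min x z * (fact B div x)) / real (fact B) = real (min x z) / real x"
proof (cases "x = 0")
  case False
  then have "x dvd fact B" using assms by (simp add: dvd_fact)
  then show ?thesis using False by (auto simp: real_of_nat_div field_simps)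
qed simp

text \<open>A draw's score is spent on coordinate \<open>i\<close> with expectation
  \<open>mu i / S\<close> per block, which the returned factor \<open>S * A i / mu i\<close>
  corrects to \<open>A i\<close>. The coin range \<open>L\<close> must be divisible by two kinds of
  totals: scores, at most \<open>k * fact B\<close>, and weights.\<close>

lemma block_value_moments:
  fixes f :: "nat \<Rightarrow> nat list"
  assumes p: "p \<ge> 2" and L: "L > 0"
    and len: "\<And>j. j < k \<Longrightarrow> length (f j) = n"
    and le: "\<And>j i. j < k \<Longrightarrow> i < n \<Longrightarrow> f j ! i \<le> B"
    and dvd: "\<And>T. T > 0 \<Longrightarrow> T \<le> k * fact B + (\<Sum>j<k. \<Sum>i<n. weight p (f j ! i)) \<Longrightarrow> T dvd L"
    and orc0: "\<And>j. j < k \<Longrightarrow> orc j 0 = sum_list (map (weight p) (f j))"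
    and orc1: "\<And>j x. j < k \<Longrightarrow> x < sum_list (map (weight p) (f j)) \<Longrightarrow>
        orc j (Suc (2 * x)) = fst (locate (map (weight p) (f j)) x)"
    and orc2: "\<And>j i. j < k \<Longrightarrow> i < n \<Longrightarrow> orc j (2 + 2 * i) = f j ! i"
  defines "uni \<equiv> pmf_of_set {..<L}"
  defines "Q \<equiv> pair_pmf (Pi_pmf {..<k} 0 (\<lambda>_. uni)) uni"
  defines "Y \<equiv> block_value p k (fact B) orc (map (\<lambda>j. orc j 0) [0..<k])"
  shows "measure_pmf.expectation Q Y = lp_pow p n (aggregate k f)"
    and "measure_pmf.expectation Q (\<lambda>\<omega>. (Y \<omega>)\<^sup>2) \<le>
      8 * real k powr (p - 2) * (lp_pow p n (aggregate k f))\<^sup>2"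
proof -
  define Ss where "Ss = map (\<lambda>j. orc j 0) [0..<k]"
  define S where "S = sum_list Ss"
  define F where "F = lp_pow p n (aggregate k f)"
  \<comment> \<open>\<open>A i\<close> is the power to be estimated; the \<open>A\<^sub>i\<close> of
    the overview is \<open>mu i\<close>.\<close>
  define A where "A i = real (aggregate k f i) powr p" for i
  define mu where "mu i = mass p k (\<lambda>j. f j ! i)" for i
  have F_eq: "F = (\<Sum>i<n. A i)" by (simp add: F_def lp_pow_def A_def)
  have A_nonneg: "A i \<ge> 0" for i by (simp add: A_def)
  have mu_nonneg: "mu i \<ge> 0" for i by (simp add: mu_def mass_nonneg)
  have mu_le: "mu i \<le> A i" for i
    using mass_le[OF p] by (simp add: mu_def A_def aggregate_def)
  have A_le: "A i \<le> 4 * real k powr (p - 2) * mu i" for i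
    using powr_sum_le_mass[OF p] by (simp add: mu_def A_def aggregate_def)
  have sum_weights: "sum_list (map (weight p) (f j)) = (\<Sum>i<n. weight p (f j ! i))" if "j < k" for j
    using len[OF that] by (simp add: sum_list_sum_nth atLeast0LessThan)
  have Ss_nth: "Ss ! j = (\<Sum>i<n. weight p (f j ! i))" if "j < k" for j
    using that by (simp add: Ss_def orc0 sum_weights)
  have len_Ss: "length Ss = k" by (simp add: Ss_def)
  have S_eq: "S = (\<Sum>j<k. \<Sum>i<n. weight p (f j ! i))"
    by (simp add: S_def sum_list_sum_nth len_Ss atLeast0LessThan Ss_nth)
  have S_le: "real S \<le> (\<Sum>i<n. mu i)"
  proof -
    have "real S = (\<Sum>i<n. \<Sum>j<k. real (weight p (f j ! i)))"
      unfolding S_eq of_nat_sum by (rule sum.swap)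
    also have "\<dots> \<le> (\<Sum>i<n. mu i)"
      unfolding mu_def by (intro sum_mono mass_ge_weights)
    finally show ?thesis .
  qed
  have "measure_pmf.expectation Q Y = F \<and>
      measure_pmf.expectation Q (\<lambda>\<omega>. (Y \<omega>)\<^sup>2) \<le> 8 * real k powr (p - 2) * F\<^sup>2"
  proof (cases "S = 0")
    case True
    have "Y = (\<lambda>_. 0)"
      using True unfolding S_def Ss_def Y_def by (intro ext block_value_eq_0)
    moreover have "mu i = 0" if "i < n" for i
      using True that unfolding S_eq mu_def mass_def by (simp add: sum_nonneg_eq_0_iff)
    then have "A i = 0" if "i < n" for i
      using A_le[of i] A_nonneg[of i] that by simp
    then have "F = 0" by (simp add: F_eq)
    ultimately show ?thesis by simp
  next
    case False
    then have S_pos: "S > 0" by simp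
    \<comment> \<open>Server, offset and coordinate of the draw with coin \<open>u\<close>.\<close>
    define jj where "jj u = fst (locate Ss (u mod S))" for u
    define off where "off u = snd (locate Ss (u mod S))" for u
    define ii where "ii u = fst (locate (map (weight p) (f (jj u))) (off u))" for u
    have jj: "jj u < k" and off: "off u < sum_list (map (weight p) (f (jj u)))" for u
    proof -
      have *: "u mod S < sum_list Ss" using S_pos by (simp add: S_def)
      show j: "jj u < k" using locate_bounds(1)[OF *] by (simp add: jj_def len_Ss)
      show "off u < sum_list (map (weight p) (f (jj u)))"
        using locate_bounds(2)[OF *] j
        unfolding jj_def[symmetric] off_def[symmetric] by (simp add: Ss_nth sum_weights)
    qed
    have ii: "ii u < n" for u
      using locate_bounds(1)[OF off[of u]] by (simp add: ii_def len jj)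
    define wt where "wt t u =
      min (f (jj u) ! ii u) (f t ! ii u) * (fact B div (f (jj u) ! ii u))" for t u
    define g where "g u = real S * A (ii u) / mu (ii u)" for u
    have Y_eq: "Y = (\<lambda>(U, V). real (sum_list (map (\<lambda>t. wt t (U t)) [0..<k])) / real (fact B) *
      g (U (fst (locate (map (\<lambda>t. wt t (U t)) [0..<k])
        (V mod sum_list (map (\<lambda>t. wt t (U t)) [0..<k]))))))"
    proof (rule ext, clarify)
      fix U V
      define js where "js = map (\<lambda>t. locate Ss (U t mod sum_list Ss)) [0..<k]"
      define is' where "is' = map (\<lambda>t. orc (fst (js ! t)) (Suc (2 * snd (js ! t)))) [0..<k]"
      define xs where "xs = map (\<lambda>t. orc (fst (js ! t)) (2 + 2 * is' ! t)) [0..<k]"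
      define zs where "zs = map (\<lambda>t. orc t (2 + 2 * is' ! t)) [0..<k]"
      define ws where "ws = map (\<lambda>t. min (xs ! t) (zs ! t) * (fact B div xs ! t)) [0..<k]"
      define r where "r = fst (locate ws (V mod sum_list ws))"
      define ys where "ys = map (\<lambda>t. orc t (2 + 2 * is' ! r)) [0..<k]"
      have is_nth: "is' ! t = ii (U t)" if "t < k" for t
        using that jj[of "U t"] off[of "U t"]
        by (simp add: is'_def js_def orc1 jj_def off_def ii_def S_def)
      have xs_nth: "xs ! t = f (jj (U t)) ! ii (U t)" if "t < k" for t
      proof -
        have "xs ! t = orc (jj (U t)) (2 + 2 * ii (U t))"
          using that is_nth[OF that] by (simp add: xs_def js_def jj_def S_def)
        then show ?thesis using orc2[OF jj ii] by simp
      qed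
      have zs_nth: "zs ! t = f t ! ii (U t)" if "t < k" for t
        using that is_nth[OF that] orc2[OF that ii] by (simp add: zs_def)
      have ws: "ws = map (\<lambda>t. wt t (U t)) [0..<k]"
        unfolding ws_def by (intro map_cong refl) (simp add: xs_nth zs_nth wt_def)
      have "Y (U, V) = real (sum_list ws) / real (fact B) *
          (real S * real (sum_list ys) powr p / mass p k (\<lambda>j. ys ! j))"
        unfolding Y_def block_value_def Let_def fst_conv snd_conv ys_def r_def ws_def zs_def
          xs_def is'_def js_def S_def Ss_def ..
      also have "\<dots> = real (sum_list ws) / real (fact B) * g (U r)"
      \<comment> \<open>If all scores vanish, \<open>r\<close> is the out-of-range index
        \<open>k\<close>, but the leading factor is 0.\<close>
      proof (cases "sum_list ws = 0")
        case False
        then have "V mod sum_list ws < sum_list ws"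
          by (simp del: sum_list_eq_0_iff)
        from locate_bounds(1)[OF this] have r: "r < k"
          by (simp add: r_def ws)
        have ys_nth: "ys ! j = f j ! ii (U r)" if "j < k" for j
          using that orc2[OF that ii] by (simp add: ys_def is_nth[OF r])
        have "sum_list ys = aggregate k f (ii (U r))"
          by (simp add: ys_def sum_list_sum_nth aggregate_def atLeast0LessThan is_nth[OF r]
              orc2[OF _ ii, simplified])
        moreover have "mass p k (\<lambda>j. ys ! j) = mu (ii (U r))"
          unfolding mu_def mass_def by (intro sum.cong refl) (simp add: ys_nth)
        ultimately show ?thesis by (simp add: g_def A_def)
      qed (simp only: of_nat_0 mult_zero_left div_0)
      finally show "Y (U, V) = real (sum_list (map (\<lambda>t. wt t (U t)) [0..<k])) / real (fact B) *
          g (U (fst (locate (map (\<lambda>t. wt t (U t)) [0..<k])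
            (V mod sum_list (map (\<lambda>t. wt t (U t)) [0..<k])))))"
        unfolding r_def ws .
    qed
    have wt_le: "wt t u \<le> fact B" for t u
    proof -
      have "wt t u \<le> (f (jj u) ! ii u) * (fact B div (f (jj u) ! ii u))"
        unfolding wt_def by (intro mult_right_mono) auto
      also have "\<dots> \<le> fact B" by simp
      finally show ?thesis .
    qed
    have g_nonneg: "g u \<ge> 0" for u
      by (simp add: g_def A_nonneg mu_nonneg)
    \<comment> \<open>Two nested uses of \<open>sum_locate\<close>: the first picks the server and a
      uniform offset, the second turns the offset into a coordinate.\<close>
    have draw: "measure_pmf.expectation uni (\<lambda>u. h (jj u) (ii u)) =
        (\<Sum>j<k. \<Sum>i<n. real (weight p (f j ! i)) * h j i) / real S" for h :: "nat \<Rightarrow> nat \<Rightarrow> real"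
    proof -
      define h' where "h' x = h (fst x) (fst (locate (map (weight p) (f (fst x))) (snd x)))" for x
      have "S dvd L" using S_pos S_eq by (intro dvd) auto
      then have "measure_pmf.expectation uni (\<lambda>u. h (jj u) (ii u)) =
          (\<Sum>v<S. h' (locate Ss v)) / real S"
        using expectation_mod[OF _ L, of S "\<lambda>v. h' (locate Ss v)"]
        by (simp add: uni_def h'_def jj_def ii_def off_def)
      also have "(\<Sum>v<S. h' (locate Ss v)) = (\<Sum>j<k. \<Sum>x<Ss ! j. h' (j, x))"
        unfolding S_def sum_locate len_Ss ..
      also have "\<dots> = (\<Sum>j<k. \<Sum>i<n. real (weight p (f j ! i)) * h j i)"
      proof (rule sum.cong[OF refl])
        fix j assume "j \<in> {..<k}"
        then have j: "j < k" by simp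
        have "(\<Sum>x<Ss ! j. h' (j, x)) = (\<Sum>x<sum_list (map (weight p) (f j)).
            (\<lambda>y. h j (fst y)) (locate (map (weight p) (f j)) x))"
          using j by (simp add: Ss_nth sum_weights h'_def)
        also have "\<dots> = (\<Sum>i<n. real (weight p (f j ! i)) * h j i)"
          using sum_locate[of "\<lambda>y. h j (fst y)" "map (weight p) (f j)"] len[OF j] by simp
        finally show "(\<Sum>x<Ss ! j. h' (j, x)) = (\<Sum>i<n. real (weight p (f j ! i)) * h j i)" .
      qed
      finally show ?thesis .
    qed
    \<comment> \<open>Used with \<open>S * A i / mu i\<close> for the mean, its square for the
      second moment, and 1 for the expected total score.\<close>
    have key: "(\<Sum>t<k. measure_pmf.expectation uni (\<lambda>u. real (wt t u) / real (fact B) * \<phi> (ii u))) =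
        (\<Sum>i<n. mu i * \<phi> i) / real S" for \<phi> :: "nat \<Rightarrow> real"
    proof -
      have ratio: "real (wt t u) / real (fact B) =
          real (min (f (jj u) ! ii u) (f t ! ii u)) / real (f (jj u) ! ii u)" for t u
        unfolding wt_def by (rule real_scaled_ratio[OF le[OF jj ii]])
      have "(\<Sum>t<k. measure_pmf.expectation uni (\<lambda>u. real (wt t u) / real (fact B) * \<phi> (ii u))) =
          (\<Sum>t<k. (\<Sum>j<k. \<Sum>i<n. real (weight p (f j ! i)) *
            (real (min (f j ! i) (f t ! i)) / real (f j ! i) * \<phi> i)) / real S)"
        unfolding ratio
        by (intro sum.cong refl
            draw[of "\<lambda>j i. real (min (f j ! i) (f _ ! i)) / real (f j ! i) * \<phi> i"])
      also have "\<dots> = (\<Sum>t<k. \<Sum>j<k. \<Sum>i<n. real (weight p (f j ! i)) *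
            (real (min (f j ! i) (f t ! i)) / real (f j ! i)) * \<phi> i) / real S"
        by (simp only: sum_divide_distrib[symmetric] mult.assoc)
      also have "(\<Sum>t<k. \<Sum>j<k. \<Sum>i<n. real (weight p (f j ! i)) *
            (real (min (f j ! i) (f t ! i)) / real (f j ! i)) * \<phi> i) =
          (\<Sum>j<k. \<Sum>t<k. \<Sum>i<n. real (weight p (f j ! i)) *
            (real (min (f j ! i) (f t ! i)) / real (f j ! i)) * \<phi> i)"
        by (rule sum.swap)
      also have "\<dots> = (\<Sum>j<k. \<Sum>i<n. \<Sum>t<k. real (weight p (f j ! i)) *
            (real (min (f j ! i) (f t ! i)) / real (f j ! i)) * \<phi> i)"
        by (intro sum.cong refl sum.swap)
      also have "\<dots> = (\<Sum>i<n. \<Sum>j<k. \<Sum>t<k. real (weight p (f j ! i)) *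
            (real (min (f j ! i) (f t ! i)) / real (f j ! i)) * \<phi> i)"
        by (rule sum.swap)
      also have "\<dots> = (\<Sum>i<n. mu i * \<phi> i)"
        unfolding mu_def mass_def sum_distrib_right ..
      finally show ?thesis .
    qed
    have dvd': "T dvd L" if "T > 0" "T \<le> k * fact B" for T
      using that by (intro dvd) auto
    note moments = resampling_moments[where wt = wt and g = g and M = "fact B" and k = k and L = L,
        OF L fact_gt_zero g_nonneg wt_le dvd', folded uni_def, folded Q_def Y_eq]
    have "measure_pmf.expectation Q Y = (\<Sum>i<n. mu i * (real S * A i / mu i)) / real S"
      using moments(1) key[of "\<lambda>i. real S * A i / mu i"] by (simp add: g_def)
    also have "\<dots> = (\<Sum>i<n. real S * A i) / real S"
    proof -
      \<comment> \<open>By \<open>A_le\<close>, \<open>mu i = 0\<close> forces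
        \<open>A i = 0\<close>, so no contribution is lost.\<close>
      have "mu i * (real S * A i / mu i) = real S * A i" for i
        using A_le[of i] A_nonneg[of i] by (cases "mu i = 0") auto
      then show ?thesis by simp
    qed
    also have "\<dots> = F"
      using S_pos by (simp add: sum_distrib_left[symmetric] F_eq)
    finally have first: "measure_pmf.expectation Q Y = F" .
    define a where "a = (\<Sum>i<n. mu i) / real S"
    define c where "c = (\<Sum>i<n. mu i * (real S * A i / mu i)\<^sup>2) / real S"
    \<comment> \<open>\<open>a\<close> is the expected total score of a block. Being at least 1, it
      absorbs the summand 1 of \<open>1 + a\<close>; its upper bound \<open>F / S\<close> then
      cancels the factor \<open>S\<close> in the bound for \<open>c\<close>.\<close>
    have "1 \<le> a" using S_le S_pos by (simp add: a_def)
    have "a \<le> F / real S"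
      unfolding a_def F_eq by (intro divide_right_mono sum_mono mu_le) auto
    have "c \<ge> 0"
      unfolding c_def using mu_nonneg by (intro divide_nonneg_nonneg sum_nonneg) auto
    have "c \<le> (\<Sum>i<n. (real S)\<^sup>2 * (4 * real k powr (p - 2)) * A i) / real S"
      unfolding c_def
    proof (intro divide_right_mono sum_mono)
      fix i
      show "mu i * (real S * A i / mu i)\<^sup>2 \<le> (real S)\<^sup>2 * (4 * real k powr (p - 2)) * A i"
      proof (cases "mu i = 0")
        case False
        then have "mu i > 0" using mu_nonneg[of i] by simp
        then have "mu i * (real S * A i / mu i)\<^sup>2 = (real S)\<^sup>2 * (A i / mu i) * A i"
          by (simp add: power2_eq_square)
        also have "A i / mu i \<le> 4 * real k powr (p - 2)"
          using A_le[of i] \<open>mu i > 0\<close> by (simp add: divide_le_eq)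
        finally show ?thesis using A_nonneg[of i] by (simp add: mult_left_mono mult_right_mono)
      qed (simp add: A_nonneg)
    qed simp
    also have "\<dots> = 4 * real k powr (p - 2) * F * real S"
      using S_pos by (simp add: sum_distrib_left[symmetric] F_eq power2_eq_square)
    finally have c_le: "c \<le> 4 * real k powr (p - 2) * F * real S" .
    have "measure_pmf.expectation Q (\<lambda>\<omega>. (Y \<omega>)\<^sup>2) \<le> (1 + a) * c"
      using moments(2) key[of "\<lambda>i. (real S * A i / mu i)\<^sup>2"] key[of "\<lambda>_. 1"]
      by (simp add: g_def a_def c_def)
    also have "\<dots> \<le> (2 * a) * c"
      using \<open>1 \<le> a\<close> \<open>c \<ge> 0\<close> by (intro mult_right_mono) auto
    also have "\<dots> \<le> (2 * (F / real S)) * (4 * real k powr (p - 2) * F * real S)"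
      using \<open>1 \<le> a\<close> \<open>a \<le> F / real S\<close> c_le \<open>c \<ge> 0\<close> by (intro mult_mono) auto
    also have "\<dots> = 8 * real k powr (p - 2) * F\<^sup>2"
      using S_pos by (simp add: power2_eq_square)
    finally show ?thesis using first by blast
  qed
  then show "measure_pmf.expectation Q Y = lp_pow p n (aggregate k f)"
    and "measure_pmf.expectation Q (\<lambda>\<omega>. (Y \<omega>)\<^sup>2) \<le>
      8 * real k powr (p - 2) * (lp_pow p n (aggregate k f))\<^sup>2"
    unfolding F_def by auto
qed

section \<open>Message length and assembly\<close>

text \<open>All answers are at most \<open>X = n * (n ^ a) ^ nat (ceiling p)\<close> and all
  relevant queries at most \<open>2 * X + 1\<close>. Of the 3 in the exponent, one factor
  \<open>n\<close> belongs to \<open>X\<close>; the other two give at least 4, so these numbers are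
  encoded without loss.\<close>

lemma responder_answer:
  assumes code: "\<And>x. x < 2 ^ l \<Longrightarrow> dec (enc x) = x"
    and adm: "admissible a n k f" and p: "p \<ge> 2" and n: "n \<ge> 2"
    and l: "n ^ (a * nat \<lceil>p\<rceil> + 3) \<le> 2 ^ l"
  defines "orc \<equiv> responder k enc dec (answer p) f"
  shows "\<And>j i. j < k \<Longrightarrow> i < n \<Longrightarrow> f j ! i \<le> n ^ a"
    and "\<And>j. j < k \<Longrightarrow> sum_list (map (weight p) (f j)) \<le> n * (n ^ a) ^ nat \<lceil>p\<rceil>"
    and "\<And>j. j < k \<Longrightarrow> orc j 0 = sum_list (map (weight p) (f j))"
    and "\<And>j x. j < k \<Longrightarrow> x < sum_list (map (weight p) (f j)) \<Longrightarrow>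
        orc j (Suc (2 * x)) = fst (locate (map (weight p) (f j)) x)"
    and "\<And>j i. j < k \<Longrightarrow> i < n \<Longrightarrow> orc j (2 + 2 * i) = f j ! i"
proof -
  let ?P = "nat \<lceil>p\<rceil>"
  have len: "length (f j) = n" if "j < k" for j
    using adm that by (simp add: admissible_def)
  show le: "f j ! i \<le> n ^ a" if "j < k" "i < n" for j i
  proof -
    have "f j ! i \<le> aggregate k f i"
      unfolding aggregate_def using that by (intro member_le_sum) auto
    then show ?thesis using adm that(2) by (fastforce simp: admissible_def)
  qed
  show total: "sum_list (map (weight p) (f j)) \<le> n * (n ^ a) ^ ?P" if j: "j < k" for j
  proof -
    have "sum_list (map (weight p) (f j)) = (\<Sum>i<n. weight p (f j ! i))"
      using len[OF j] by (simp add: sum_list_sum_nth atLeast0LessThan)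
    also have "\<dots> \<le> (\<Sum>i<n. (n ^ a) ^ ?P)"
      using p j by (intro sum_mono weight_le_power le) auto
    finally show ?thesis by simp
  qed
  define X where "X = n * (n ^ a) ^ ?P"
  have P: "?P \<ge> 1" using p by linarith
  have na: "n ^ a \<ge> 1" using n by simp
  have "n * 1 \<le> X" unfolding X_def using na by (intro mult_le_mono) auto
  then have nX: "n \<le> X" by simp
  have "n ^ a * 1 \<le> (n ^ a) ^ ?P"
    using power_increasing[OF P na] by simp
  then have aX: "n ^ a \<le> X" unfolding X_def using n
    by (metis One_nat_def Suc_le_eq mult.commute mult.right_neutral mult_le_mono
        le_trans one_le_numeral)
  have "2 * 2 * X \<le> n * n * X" using n by (intro mult_le_mono) auto
  also have "\<dots> = n ^ (a * ?P + 3)"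
    by (simp add: X_def power_mult power_add power3_eq_cube)
  finally have big: "4 * X \<le> 2 ^ l" using l by linarith
  have X1: "X \<ge> 2" using nX n by linarith
  have code': "dec (enc x) = x" if "x \<le> 2 * X + 1" for x
    using that big X1 by (intro code) linarith
  show "orc j 0 = sum_list (map (weight p) (f j))" if j: "j < k" for j
    using total[OF j] j by (simp add: orc_def responder_def code' answer_def X_def)
  show "orc j (Suc (2 * x)) = fst (locate (map (weight p) (f j)) x)"
    if j: "j < k" and x: "x < sum_list (map (weight p) (f j))" for j x
  proof -
    have "Suc (2 * x) \<le> 2 * X + 1" using total[OF j] x by (simp add: X_def)
    moreover have "fst (locate (map (weight p) (f j)) x) \<le> 2 * X + 1"
      using locate_bounds(1)[OF x] len[OF j] nX by simp
    ultimately show ?thesis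
      using j by (simp add: orc_def responder_def code' answer_def)
  qed
  show "orc j (2 + 2 * i) = f j ! i" if j: "j < k" and i: "i < n" for j i
  proof -
    have "2 + 2 * i \<le> 2 * X + 1" using i nX by linarith
    moreover have "f j ! i \<le> 2 * X + 1" using le[OF j i] aX by linarith
    moreover have "answer p (f j) (2 + 2 * i) = f j ! i" by (simp add: answer_def)
    ultimately show ?thesis
      using j unfolding orc_def responder_def by (simp only: code' mod_less)
  qed
qed

theorem mainTheorem10:
  fixes p :: real
  assumes "2 \<le> p"
  shows "\<exists>C::real. \<forall>(a::nat) (c::real). c > 0 \<longrightarrow>
    (\<exists>(D::real) (d::nat). \<forall>n\<ge>2. \<forall>k\<ge>1. \<exists>P. valid_protocol k P \<and>
      (\<forall>f. admissible a n k f \<longrightarrow>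
         measure_pmf.prob (result_pmf k P f) (range Some) \<ge> 1 - 1 / real n powr c \<and>
         integrable (estimate_pmf k P f) (\<lambda>X. X) \<and>
         measure_pmf.expectation (estimate_pmf k P f) (\<lambda>X. X) = lp_pow p n (aggregate k f) \<and>
         integrable (estimate_pmf k P f) (\<lambda>X. X\<^sup>2) \<and>
         measure_pmf.expectation (estimate_pmf k P f) (\<lambda>X. X\<^sup>2)
           \<le> C * (lp_pow p n (aggregate k f))\<^sup>2 \<and>
         uses_at_most k P f (D * real k powr (p - 1) * (log 2 (real n)) ^ d)))"
proof (rule exI[of _ 9], intro allI impI)
  fix a :: nat and c :: real
  define e where "e = a * nat \<lceil>p\<rceil> + 3"
  show "\<exists>(D::real) (d::nat). \<forall>n\<ge>2. \<forall>k\<ge>1. \<exists>P. valid_protocol k P \<and>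
      (\<forall>f. admissible a n k f \<longrightarrow>
         measure_pmf.prob (result_pmf k P f) (range Some) \<ge> 1 - 1 / real n powr c \<and>
         integrable (estimate_pmf k P f) (\<lambda>X. X) \<and>
         measure_pmf.expectation (estimate_pmf k P f) (\<lambda>X. X) = lp_pow p n (aggregate k f) \<and>
         integrable (estimate_pmf k P f) (\<lambda>X. X\<^sup>2) \<and>
         measure_pmf.expectation (estimate_pmf k P f) (\<lambda>X. X\<^sup>2)
           \<le> 9 * (lp_pow p n (aggregate k f))\<^sup>2 \<and>
         uses_at_most k P f (D * real k powr (p - 1) * (log 2 (real n)) ^ d))"
  \<comment> \<open>A query and its reply take \<open>2 * l\<close> bits with
    \<open>l <= 2 * e * log 2 n\<close>, and there are at most \<open>9 * k powr (p - 1)\<close>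
    queries, whence 36.\<close>
  proof (rule exI[of _ "36 * real e"], rule exI[of _ 1], intro allI impI)
    fix n k :: nat assume n: "n \<ge> 2" and k: "k \<ge> 1"
    define lam where "lam = nat \<lceil>log 2 (real n)\<rceil>"
    define l where "l = e * lam"
    have log_ge: "log 2 (real n) \<ge> 1" using n by (simp add: le_log_iff)
    have lam_le: "real lam \<le> 2 * log 2 (real n)"
      unfolding lam_def using log_ge by linarith
    have lam_ge: "log 2 (real n) \<le> real lam"
      unfolding lam_def by (rule real_nat_ceiling_ge)
    have "real n = 2 powr (log 2 (real n))" using n by simp
    also have "\<dots> \<le> 2 powr real lam" using lam_ge by (intro powr_mono) auto
    also have "\<dots> = real (2 ^ lam)" by (simp add: powr_realpow)
    finally have "n \<le> 2 ^ lam" by (simp only: of_nat_le_iff)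
    then have "n ^ e \<le> (2 ^ lam) ^ e" by (intro power_mono) auto
    then have n_le: "n ^ (a * nat \<lceil>p\<rceil> + 3) \<le> 2 ^ l"
      by (simp add: l_def e_def power_mult[symmetric] mult.commute)
    have "lam \<ge> 1" using log_ge lam_ge by linarith
    then have "l \<ge> 1" by (simp add: l_def e_def)
    obtain enc :: "nat \<Rightarrow> message" and dec :: "message \<Rightarrow> nat" where
      enc_dec: "\<forall>x<2 ^ l. dec (enc x) = x" and enc_length: "\<forall>x. length (enc x) = l"
      using fixed_length_code_exists[of l] by metis
    have code: "\<And>x. x < 2 ^ l \<Longrightarrow> dec (enc x) = x" "\<And>x. length (enc x) = l" "\<And>x. enc x \<noteq> []"
      using enc_dec enc_length \<open>l \<ge> 1\<close> by (auto simp flip: length_greater_0_conv)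
    define B where "B = n ^ a"
    \<comment> \<open>Averaging this many blocks reduces the factor
      \<open>8 * k powr (p - 2)\<close> of the block's second moment to 8; the squared mean raises
      it to 9.\<close>
    define m where "m = nat \<lceil>real k powr (p - 2)\<rceil>"
    \<comment> \<open>A multiple of every total that can occur, chosen without reference to the
      input because the protocol is fixed first. Its size is irrelevant to the cost, as coins are
      never sent.\<close>
    define L :: nat where "L = fact (k * fact B + k * (n * B ^ nat \<lceil>p\<rceil>))"
    define uni where "uni = pmf_of_set {..<L}"
    define Q where "Q = pair_pmf (Pi_pmf {..<k} 0 (\<lambda>_. uni)) uni"
    define R where "R = Pi_pmf {..<m} (\<lambda>_. 0, 0) (\<lambda>_. Q)"
    define pr where "pr = estimator p k (fact B) m"
    define P where "P = compiled k enc dec (answer p) R pr"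
    have kp: "real k powr (p - 2) \<ge> 1"
      using k assms by (intro ge_one_powr_ge_zero) auto
    have m_ge: "real k powr (p - 2) \<le> real m"
      unfolding m_def by (rule real_nat_ceiling_ge)
    have m_le: "real m \<le> 2 * real k powr (p - 2)"
      unfolding m_def using kp by linarith
    have m1: "m \<ge> 1" using m_ge kp by linarith
    have "L > 0" by (simp add: L_def)
    then have fin_uni: "finite (set_pmf uni)"
      unfolding uni_def by (subst set_pmf_of_set) auto
    have fin_Q: "finite (set_pmf Q)"
      unfolding Q_def by (auto intro!: finite_set_Pi_pmf fin_uni)
    have fin_R: "finite (set_pmf R)"
      unfolding R_def by (auto intro!: finite_set_Pi_pmf fin_Q)
    have k_powr: "real k * real k powr (p - 2) = real k powr (p - 1)"
      using k by (simp add: powr_diff power2_eq_square)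
    have cost: "real (2 * l * (k + m * (4 * k))) \<le>
        36 * real e * real k powr (p - 1) * log 2 (real n) ^ 1"
    proof -
      have "real (k + m * (4 * k)) = real k * (1 + 4 * real m)"
        by (simp add: algebra_simps)
      also have "\<dots> \<le> real k * (9 * real k powr (p - 2))"
        using m_le kp by (intro mult_left_mono) auto
      also have "\<dots> = 9 * real k powr (p - 1)"
        using k_powr by simp
      finally have N: "real (k + m * (4 * k)) \<le> 9 * real k powr (p - 1)" .
      have "real (2 * l * (k + m * (4 * k))) = (2 * real e * real lam) * real (k + m * (4 * k))"
        by (simp add: l_def)
      also have "\<dots> \<le> (2 * real e * (2 * log 2 (real n))) * (9 * real k powr (p - 1))"
        using lam_le N log_ge by (intro mult_mono mult_nonneg_nonneg) auto
      finally show ?thesis by (simp add: mult_ac)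
    qed
    show "\<exists>P. valid_protocol k P \<and>
      (\<forall>f. admissible a n k f \<longrightarrow>
         measure_pmf.prob (result_pmf k P f) (range Some) \<ge> 1 - 1 / real n powr c \<and>
         integrable (estimate_pmf k P f) (\<lambda>X. X) \<and>
         measure_pmf.expectation (estimate_pmf k P f) (\<lambda>X. X) = lp_pow p n (aggregate k f) \<and>
         integrable (estimate_pmf k P f) (\<lambda>X. X\<^sup>2) \<and>
         measure_pmf.expectation (estimate_pmf k P f) (\<lambda>X. X\<^sup>2)
           \<le> 9 * (lp_pow p n (aggregate k f))\<^sup>2 \<and>
         uses_at_most k P f (36 * real e * real k powr (p - 1) * (log 2 (real n)) ^ 1))"
    proof (rule exI[of _ P], rule conjI, goal_cases)
      case 1
      show ?case unfolding P_def using k code(3) by (rule valid_protocol_compiled)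
    next
      case 2
      show ?case
      proof (intro allI impI)
        fix f assume adm: "admissible a n k f"
        define orc where "orc = responder k enc dec (answer p) f"
        define Y where "Y = block_value p k (fact B) orc (map (\<lambda>j. orc j 0) [0..<k])"
        define F where "F = lp_pow p n (aggregate k f)"
        note orc = responder_answer[OF code(1) adm assms n n_le, folded orc_def B_def]
        have len: "length (f j) = n" if "j < k" for j
          using adm that by (simp add: admissible_def)
        have weights: "(\<Sum>j<k. \<Sum>i<n. weight p (f j ! i)) \<le> k * (n * B ^ nat \<lceil>p\<rceil>)"
        proof -
          have "(\<Sum>j<k. \<Sum>i<n. weight p (f j ! i)) = (\<Sum>j<k. sum_list (map (weight p) (f j)))"
            using len by (intro sum.cong) (auto simp: sum_list_sum_nth atLeast0LessThan)
          also have "\<dots> \<le> (\<Sum>j<k. n * B ^ nat \<lceil>p\<rceil>)"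
            using orc(2) by (intro sum_mono) auto
          finally show ?thesis by simp
        qed
        have dvd: "T dvd L"
          if "T > 0" "T \<le> k * fact B + (\<Sum>j<k. \<Sum>i<n. weight p (f j ! i))" for T
          unfolding L_def using that weights by (intro dvd_fact) auto
        note block = block_value_moments[where f = f and k = k and orc = orc, OF assms \<open>L > 0\<close> len orc(1) dvd orc(3,4,5),
            folded uni_def, folded Q_def Y_def F_def]
        have Y_nonneg: "Y \<omega> \<ge> 0" for \<omega>
          unfolding Y_def by (rule block_value_nonneg)
        note avg = iid_average_moments[where Y = Y and d = "(\<lambda>_. 0, 0)", OF m1 fin_Q Y_nonneg, folded R_def]
        have "result_pmf k P f = map_pmf (\<lambda>\<omega>. Some ((\<Sum>b<m. Y (\<omega> b)) / real m)) R"
          unfolding P_def result_pmf_compiled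
          by (simp add: orc_def[symmetric] pr_def outcome_estimator Y_def)
        note est = estimate_pmf_eq[OF this]
        have "finite (set_pmf (estimate_pmf k P f))" using fin_R by (simp add: est(1))
        then have int: "integrable (estimate_pmf k P f) h" for h :: "real \<Rightarrow> real"
          by (rule integrable_measure_pmf_finite)
        have "measure_pmf.expectation (estimate_pmf k P f) (\<lambda>X. X) = F"
          using avg(1) block(1) by (simp add: est(1))
        moreover have "measure_pmf.expectation (estimate_pmf k P f) (\<lambda>X. X\<^sup>2) \<le> 9 * F\<^sup>2"
        proof -
          have "measure_pmf.expectation (estimate_pmf k P f) (\<lambda>X. X\<^sup>2) \<le>
              F\<^sup>2 + measure_pmf.expectation Q (\<lambda>x. (Y x)\<^sup>2) / real m"
            using avg(2) block(1) by (simp add: est(1))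
          also have "\<dots> \<le> F\<^sup>2 + 8 * F\<^sup>2"
          proof -
            have "measure_pmf.expectation Q (\<lambda>x. (Y x)\<^sup>2) \<le> 8 * real k powr (p - 2) * F\<^sup>2"
              by (rule block(2))
            also have "\<dots> \<le> 8 * real m * F\<^sup>2"
              using m_ge by (intro mult_right_mono mult_left_mono) auto
            finally show ?thesis using m1 by (simp add: divide_le_eq mult_ac)
          qed
          finally show ?thesis by simp
        qed
        moreover have "uses_at_most k P f
            (36 * real e * real k powr (p - 1) * (log 2 (real n)) ^ 1)"
          unfolding P_def
          by (rule uses_at_most_compiled[OF code(2) _ cost])
            (simp add: pr_def length_queries_estimator)
        ultimately show "measure_pmf.prob (result_pmf k P f) (range Some) \<ge> 1 - 1 / real n powr c \<and>
         integrable (estimate_pmf k P f) (\<lambda>X. X) \<and>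
         measure_pmf.expectation (estimate_pmf k P f) (\<lambda>X. X) = lp_pow p n (aggregate k f) \<and>
         integrable (estimate_pmf k P f) (\<lambda>X. X\<^sup>2) \<and>
         measure_pmf.expectation (estimate_pmf k P f) (\<lambda>X. X\<^sup>2)
           \<le> 9 * (lp_pow p n (aggregate k f))\<^sup>2 \<and>
         uses_at_most k P f (36 * real e * real k powr (p - 1) * (log 2 (real n)) ^ 1)"
          using int est(2) unfolding F_def by auto
      qed
    qed
  qed
qed

end
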